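(* Let $(X_n)_n$ be a sequence of Banach spaces, $1\leq q<\infty$ and $1<p<\infty$. Then $(\sum_{n=1}^{\infty}\oplus X_n)_p$ has property $q$-$(V)$ if and only if each $X_n$ has property $q$-$(V)$.
   Context: Operators are bounded linear operators. For $1\le q<\infty$, a sequence $(x_n)_n$ in a Banach space $X$ is weakly $q$-summable if $\sum_{n}|\langle x^{*},x_n\rangle|^{q}<\infty$ for every $x^{*}\in X^{*}$; it is unconditionally $q$-summable if moreover $\sup\{(\sum_{n=m}^{\infty}|\langle x^{*},x_n\rangle|^{q})^{1/q}: x^{*}\in B_{X^{*}}\}\to 0$ as $m\to\infty$, where $B_{X^*}$ is the closed unit ball of $X^*$. An operator $T:X\to Y$ is unconditionally $q$-converging if it takes weakly $q$-summable sequences in $X$ to unconditionally $q$-summable sequences in $Y$. A Banach space $X$ has property $q$-$(V)$ (Pe{\l}czy\'nski's property $(V)$ of order $q$) if for every Banach space $Y$, every unconditionally $q$-converging operator $T:X\to Y$ is weakly compact. $(\sum_{n}\oplus X_n)_p$ is the Banach space of all $x=(x_n)_n$ with $x_n\in X_n$ and $\|x\|=(\sum_n\|x_n\|^p)^{1/p}<\infty$. *)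

theory Defs
  imports "HOL-Analysis.Analysis" "HOL-Algebra.Module"
begin

text \<open>
  Banach spaces are carrier-based, so that one can speak about sequences of different spaces and
  quantify over spaces inside a definition. The spaces of a sequence have carriers in one common
  type, which is no restriction, as any sequence of spaces can be copied into such a type. They are modules in the sense of HOL-Algebra over the
  scalar field, together with a norm; the multiplicative fields \<open>mult\<close> and \<open>one\<close> that the
  \<open>module\<close> record inherits from rings play no role.
\<close>

text \<open>The scalar field is either the reals or the complex numbers, with the usual absolute value.\<close>

class real_or_complex = real_normed_field +
  assumes real_or_complex:
    "(\<forall>z. \<exists>a. z = a *\<^sub>R 1) \<or>
     (\<exists>i. i * i = - 1 \<and> (\<forall>z. \<exists>a b. z = a *\<^sub>R 1 + b *\<^sub>R i) \<and>
        (\<forall>a b. norm (a *\<^sub>R 1 + b *\<^sub>R i) = sqrt (a\<^sup>2 + b\<^sup>2)))"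

instance real :: real_or_complex
  by standard auto

instance complex :: real_or_complex
proof
  have "\<exists>a b. z = a *\<^sub>R 1 + b *\<^sub>R \<i>" for z
    by (rule exI[of _ "Re z"], rule exI[of _ "Im z"]) (simp add: complex_eq_iff)
  moreover have "norm (a *\<^sub>R 1 + b *\<^sub>R \<i>) = sqrt (a\<^sup>2 + b\<^sup>2)" for a b
    by (simp add: cmod_def)
  ultimately show "(\<forall>z::complex. \<exists>a. z = a *\<^sub>R 1) \<or>
     (\<exists>i::complex. i * i = - 1 \<and> (\<forall>z. \<exists>a b. z = a *\<^sub>R 1 + b *\<^sub>R i) \<and>
        (\<forall>a b. norm (a *\<^sub>R 1 + b *\<^sub>R i) = sqrt (a\<^sup>2 + b\<^sup>2)))"
    by (intro disjI2 exI[of _ \<i>]) auto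
qed

record ('k, 'a) normed_space = "('k, 'a) module" +
  vnorm :: "'a \<Rightarrow> real"

text \<open>The scalar field, both as a ring and as a one-dimensional normed space over itself.\<close>

definition scalar_field :: "('k::real_or_complex, 'k) normed_space" where
  "scalar_field =
     \<lparr>carrier = UNIV, monoid.mult = (*), one = 1, zero = 0, add = (+), smult = (*), vnorm = norm\<rparr>"

definition is_normed_space :: "('k::real_or_complex, 'a) normed_space \<Rightarrow> bool" where
  "is_normed_space X \<longleftrightarrow> module (scalar_field :: ('k, 'k) normed_space) X \<and>
     (\<forall>x\<in>carrier X. 0 \<le> vnorm X x \<and> (vnorm X x = 0 \<longleftrightarrow> x = \<zero>\<^bsub>X\<^esub>)) \<and>
     (\<forall>a. \<forall>x\<in>carrier X. vnorm X (a \<odot>\<^bsub>X\<^esub> x) = norm a * vnorm X x) \<and>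
     (\<forall>x\<in>carrier X. \<forall>y\<in>carrier X. vnorm X (x \<oplus>\<^bsub>X\<^esub> y) \<le> vnorm X x + vnorm X y)"

definition is_banach_space :: "('k::real_or_complex, 'a) normed_space \<Rightarrow> bool" where
  "is_banach_space X \<longleftrightarrow> is_normed_space X \<and>
     (\<forall>s. (\<forall>n. s n \<in> carrier X) \<and>
          (\<forall>e>0. \<exists>N. \<forall>m\<ge>N. \<forall>n\<ge>N. vnorm X (s m \<ominus>\<^bsub>X\<^esub> s n) < e) \<longrightarrow>
          (\<exists>x\<in>carrier X. (\<lambda>n. vnorm X (s n \<ominus>\<^bsub>X\<^esub> x)) \<longlonglongrightarrow> 0))"

definition unit_ball :: "('k, 'a) normed_space \<Rightarrow> 'a set" where
  "unit_ball X = {x \<in> carrier X. vnorm X x \<le> 1}"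

text \<open>Values of a map outside the carrier of its domain are irrelevant throughout.\<close>

definition bounded_operator ::
  "('k, 'a) normed_space \<Rightarrow> ('k, 'b) normed_space \<Rightarrow> ('a \<Rightarrow> 'b) \<Rightarrow> bool" where
  "bounded_operator X Y T \<longleftrightarrow> T \<in> carrier X \<rightarrow> carrier Y \<and>
     (\<forall>x\<in>carrier X. \<forall>y\<in>carrier X. T (x \<oplus>\<^bsub>X\<^esub> y) = T x \<oplus>\<^bsub>Y\<^esub> T y) \<and>
     (\<forall>a. \<forall>x\<in>carrier X. T (a \<odot>\<^bsub>X\<^esub> x) = a \<odot>\<^bsub>Y\<^esub> T x) \<and>
     (\<exists>C. \<forall>x\<in>carrier X. vnorm Y (T x) \<le> C * vnorm X x)"

definition dual :: "('k::real_or_complex, 'a) normed_space \<Rightarrow> ('a \<Rightarrow> 'k) set" where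
  "dual X = {f. bounded_operator X scalar_field f}"

definition dual_norm :: "('k::real_or_complex, 'a) normed_space \<Rightarrow> ('a \<Rightarrow> 'k) \<Rightarrow> real" where
  "dual_norm X f = (SUP x\<in>unit_ball X. norm (f x))"

definition dual_ball :: "('k::real_or_complex, 'a) normed_space \<Rightarrow> ('a \<Rightarrow> 'k) set" where
  "dual_ball X = {f \<in> dual X. dual_norm X f \<le> 1}"

definition weakly_summable ::
  "real \<Rightarrow> ('k::real_or_complex, 'a) normed_space \<Rightarrow> (nat \<Rightarrow> 'a) \<Rightarrow> bool" where
  "weakly_summable q X x \<longleftrightarrow> (\<forall>n. x n \<in> carrier X) \<and>
     (\<forall>f\<in>dual X. summable (\<lambda>n. norm (f (x n)) powr q))"

text \<open>The supremum is taken in the extended reals, so that it is meaningful without any appeal to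
  the uniform boundedness principle.\<close>

definition unconditionally_summable ::
  "real \<Rightarrow> ('k::real_or_complex, 'a) normed_space \<Rightarrow> (nat \<Rightarrow> 'a) \<Rightarrow> bool" where
  "unconditionally_summable q X x \<longleftrightarrow> weakly_summable q X x \<and>
     (\<lambda>m. SUP f\<in>dual_ball X. ereal ((\<Sum>n. norm (f (x (m + n))) powr q) powr (1 / q)))
       \<longlonglongrightarrow> 0"

definition unconditionally_converging ::
  "real \<Rightarrow> ('k::real_or_complex, 'a) normed_space \<Rightarrow> ('k, 'b) normed_space \<Rightarrow> ('a \<Rightarrow> 'b) \<Rightarrow> bool"
  where
  "unconditionally_converging q X Y T \<longleftrightarrow> bounded_operator X Y T \<and>
     (\<forall>x. weakly_summable q X x \<longrightarrow> unconditionally_summable q Y (\<lambda>n. T (x n)))"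

definition weak_topology :: "('k::real_or_complex, 'a) normed_space \<Rightarrow> 'a topology" where
  "weak_topology X =
     topology_generated_by {{x \<in> carrier X. f x \<in> U} | f U. f \<in> dual X \<and> open U}"

definition weakly_compact_operator ::
  "('k::real_or_complex, 'a) normed_space \<Rightarrow> ('k, 'b) normed_space \<Rightarrow> ('a \<Rightarrow> 'b) \<Rightarrow> bool" where
  "weakly_compact_operator X Y T \<longleftrightarrow> bounded_operator X Y T \<and>
     compactin (weak_topology Y) (weak_topology Y closure_of (T ` unit_ball X))"

text \<open>
  Property \<open>q\<close>-\<open>(V)\<close>. A HOL formula cannot quantify over all types, so the target spaces \<open>Y\<close> are
  those whose carrier is a subset of the type \<open>nat \<Rightarrow> 'a\<close>. This is no restriction: an operator can
  be replaced by its corestriction to the closure of its range, each element of which is determined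
  by a sequence in \<open>X\<close>. Theorem \<open>property_V_all_targets\<close> at the end of this theory
  proves that the property implies the same statement for Banach spaces \<open>Y\<close> over every type.
\<close>

definition property_V :: "real \<Rightarrow> ('k::real_or_complex, 'a) normed_space \<Rightarrow> bool" where
  "property_V q X \<longleftrightarrow>
     (\<forall>(Y :: ('k, nat \<Rightarrow> 'a) normed_space) T.
        is_banach_space Y \<and> unconditionally_converging q X Y T \<longrightarrow> weakly_compact_operator X Y T)"

definition lp_sum ::
  "real \<Rightarrow> (nat \<Rightarrow> ('k, 'a) normed_space) \<Rightarrow> ('k, nat \<Rightarrow> 'a) normed_space" where
  "lp_sum p X =
     \<lparr>carrier = {x. (\<forall>n. x n \<in> carrier (X n)) \<and> summable (\<lambda>n. vnorm (X n) (x n) powr p)},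
      monoid.mult = undefined, one = undefined,
      zero = (\<lambda>n. \<zero>\<^bsub>X n\<^esub>), add = (\<lambda>x y n. x n \<oplus>\<^bsub>X n\<^esub> y n),
      smult = (\<lambda>a x n. a \<odot>\<^bsub>X n\<^esub> x n),
      vnorm = (\<lambda>x. (\<Sum>n. vnorm (X n) (x n) powr p) powr (1 / p))\<rparr>"

lemma scalar_field_simps [simp]:
  "carrier (scalar_field :: ('k::real_or_complex, 'k) normed_space) = UNIV"
  "a \<oplus>\<^bsub>scalar_field\<^esub> b = (a + b :: 'k)"
  "a \<otimes>\<^bsub>scalar_field\<^esub> b = (a * b :: 'k)"
  "a \<odot>\<^bsub>scalar_field\<^esub> b = (a * b :: 'k)"
  "\<zero>\<^bsub>scalar_field\<^esub> = (0 :: 'k)"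
  "\<one>\<^bsub>scalar_field\<^esub> = (1 :: 'k)"
  "vnorm (scalar_field :: ('k, 'k) normed_space) = norm"
  by (simp_all add: scalar_field_def)

lemma cring_scalar_field: "cring (scalar_field :: ('k::real_or_complex, 'k) normed_space)"
proof (rule cringI)
  show "abelian_group (scalar_field :: ('k, 'k) normed_space)"
  proof (rule abelian_groupI)
    show "\<exists>y\<in>carrier scalar_field. y \<oplus>\<^bsub>scalar_field\<^esub> x = \<zero>\<^bsub>scalar_field\<^esub>" for x :: 'k
      by (rule bexI[of _ "- x"]) auto
  qed (auto simp: add.assoc add.commute)
  show "comm_monoid (scalar_field :: ('k, 'k) normed_space)"
    by (rule comm_monoidI) (auto simp: mult.assoc mult.commute)
qed (auto simp: distrib_right)

context
  fixes Y :: "('k::real_or_complex, 'a) normed_space"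
  assumes ns: "is_normed_space Y"
begin

interpretation module "scalar_field :: ('k, 'k) normed_space" Y
  using ns by (simp add: is_normed_space_def)

lemma ns_zero: "\<zero>\<^bsub>Y\<^esub> \<in> carrier Y"
  and ns_add: "x \<in> carrier Y \<Longrightarrow> y \<in> carrier Y \<Longrightarrow> x \<oplus>\<^bsub>Y\<^esub> y \<in> carrier Y"
  and ns_scale: "x \<in> carrier Y \<Longrightarrow> a \<odot>\<^bsub>Y\<^esub> x \<in> carrier Y"
  and ns_minus: "x \<in> carrier Y \<Longrightarrow> y \<in> carrier Y \<Longrightarrow> x \<ominus>\<^bsub>Y\<^esub> y \<in> carrier Y"
  and ns_scale_scale: "x \<in> carrier Y \<Longrightarrow> a \<odot>\<^bsub>Y\<^esub> (b \<odot>\<^bsub>Y\<^esub> x) = (a * b) \<odot>\<^bsub>Y\<^esub> x"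
  and ns_scale_add:
    "x \<in> carrier Y \<Longrightarrow> y \<in> carrier Y \<Longrightarrow> a \<odot>\<^bsub>Y\<^esub> (x \<oplus>\<^bsub>Y\<^esub> y) = a \<odot>\<^bsub>Y\<^esub> x \<oplus>\<^bsub>Y\<^esub> a \<odot>\<^bsub>Y\<^esub> y"
  and ns_add_scale: "x \<in> carrier Y \<Longrightarrow> (a + b) \<odot>\<^bsub>Y\<^esub> x = a \<odot>\<^bsub>Y\<^esub> x \<oplus>\<^bsub>Y\<^esub> b \<odot>\<^bsub>Y\<^esub> x"
  and ns_one: "x \<in> carrier Y \<Longrightarrow> 1 \<odot>\<^bsub>Y\<^esub> x = x"
  and ns_scale_0: "x \<in> carrier Y \<Longrightarrow> 0 \<odot>\<^bsub>Y\<^esub> x = \<zero>\<^bsub>Y\<^esub>"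
  using smult_closed[of a x] smult_assoc1[of a b x] smult_r_distr[of a x y] smult_l_distr[of a b x]
    smult_one[of x] smult_l_null[of x] by auto

lemma ns_scale_zero: "a \<odot>\<^bsub>Y\<^esub> \<zero>\<^bsub>Y\<^esub> = \<zero>\<^bsub>Y\<^esub>"
  using smult_r_null[of a] by simp

lemma ns_minus_eq:
  assumes "x \<in> carrier Y" "y \<in> carrier Y"
  shows "x \<ominus>\<^bsub>Y\<^esub> y = x \<oplus>\<^bsub>Y\<^esub> (- 1) \<odot>\<^bsub>Y\<^esub> y"
proof -
  have "(- 1) \<odot>\<^bsub>Y\<^esub> y \<oplus>\<^bsub>Y\<^esub> y = ((- 1) + 1) \<odot>\<^bsub>Y\<^esub> y"
    using assms by (simp only: ns_add_scale ns_one)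
  then have "(- 1) \<odot>\<^bsub>Y\<^esub> y \<oplus>\<^bsub>Y\<^esub> y = \<zero>\<^bsub>Y\<^esub>"
    using assms by (simp add: ns_scale_0)
  then have "\<ominus>\<^bsub>Y\<^esub> y = (- 1) \<odot>\<^bsub>Y\<^esub> y"
    using assms by (intro M.minus_equality) (auto simp: ns_scale)
  then show ?thesis by (simp add: a_minus_def)
qed

lemma ns_minus_eq_zero_iff:
  assumes "x \<in> carrier Y" "y \<in> carrier Y"
  shows "x \<ominus>\<^bsub>Y\<^esub> y = \<zero>\<^bsub>Y\<^esub> \<longleftrightarrow> x = y"
  using assms by (metis M.a_inv_closed M.minus_equality M.minus_minus M.r_neg a_minus_def)

lemma ns_norm_ge: "x \<in> carrier Y \<Longrightarrow> 0 \<le> vnorm Y x"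
  and ns_norm_eq: "x \<in> carrier Y \<Longrightarrow> vnorm Y x = 0 \<longleftrightarrow> x = \<zero>\<^bsub>Y\<^esub>"
  and ns_norm_scale: "x \<in> carrier Y \<Longrightarrow> vnorm Y (a \<odot>\<^bsub>Y\<^esub> x) = norm a * vnorm Y x"
  and ns_norm_triangle:
    "x \<in> carrier Y \<Longrightarrow> y \<in> carrier Y \<Longrightarrow> vnorm Y (x \<oplus>\<^bsub>Y\<^esub> y) \<le> vnorm Y x + vnorm Y y"
  using ns by (auto simp: is_normed_space_def)

lemma ns_norm_zero: "vnorm Y \<zero>\<^bsub>Y\<^esub> = 0"
  using ns_norm_eq[OF ns_zero] by simp

lemma ns_norm_minus_commute:
  assumes "x \<in> carrier Y" "y \<in> carrier Y"
  shows "vnorm Y (x \<ominus>\<^bsub>Y\<^esub> y) = vnorm Y (y \<ominus>\<^bsub>Y\<^esub> x)"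
proof -
  have "(- 1) \<odot>\<^bsub>Y\<^esub> (x \<ominus>\<^bsub>Y\<^esub> y) = y \<ominus>\<^bsub>Y\<^esub> x"
    using assms
    by (simp add: ns_minus_eq ns_scale_add ns_scale ns_scale_scale ns_one M.a_comm)
  then show ?thesis
    using ns_norm_scale[of "x \<ominus>\<^bsub>Y\<^esub> y" "- 1"] assms by (simp add: ns_minus)
qed

lemma ns_norm_minus_triangle:
  assumes "x \<in> carrier Y" "y \<in> carrier Y" "z \<in> carrier Y"
  shows "vnorm Y (x \<ominus>\<^bsub>Y\<^esub> z) \<le> vnorm Y (x \<ominus>\<^bsub>Y\<^esub> y) + vnorm Y (y \<ominus>\<^bsub>Y\<^esub> z)"
proof -
  have "(x \<ominus>\<^bsub>Y\<^esub> y) \<oplus>\<^bsub>Y\<^esub> (y \<ominus>\<^bsub>Y\<^esub> z) = x \<ominus>\<^bsub>Y\<^esub> z"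
  proof -
    have "(x \<ominus>\<^bsub>Y\<^esub> y) \<oplus>\<^bsub>Y\<^esub> (y \<ominus>\<^bsub>Y\<^esub> z) = x \<oplus>\<^bsub>Y\<^esub> ((\<ominus>\<^bsub>Y\<^esub> y \<oplus>\<^bsub>Y\<^esub> y) \<oplus>\<^bsub>Y\<^esub> \<ominus>\<^bsub>Y\<^esub> z)"
      using assms by (simp add: a_minus_def M.a_assoc)
    then show ?thesis using assms by (simp add: a_minus_def M.l_neg)
  qed
  then show ?thesis using assms by (metis ns_norm_triangle ns_minus)
qed

lemma ns_eq_iff:
  assumes "x \<in> carrier Y" "y \<in> carrier Y"
  shows "vnorm Y (x \<ominus>\<^bsub>Y\<^esub> y) = 0 \<longleftrightarrow> x = y"
  using assms ns_norm_eq[OF ns_minus[OF assms]] by (simp add: ns_minus_eq_zero_iff)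

lemma ns_norm_le_minus:
  assumes "x \<in> carrier Y" "y \<in> carrier Y"
  shows "vnorm Y x \<le> vnorm Y (x \<ominus>\<^bsub>Y\<^esub> y) + vnorm Y y"
proof -
  have "(x \<ominus>\<^bsub>Y\<^esub> y) \<oplus>\<^bsub>Y\<^esub> y = x"
    using assms by (simp add: a_minus_def M.a_assoc M.l_neg)
  then show ?thesis using assms by (metis ns_norm_triangle ns_minus)
qed

text \<open>Hahn--Banach, first for real-linear functionals given by their graphs.\<close>

definition dominated_graph :: "real \<Rightarrow> ('a \<times> real) set \<Rightarrow> bool" where
  "dominated_graph C G \<longleftrightarrow> (\<zero>\<^bsub>Y\<^esub>, 0) \<in> G \<and>
     (\<forall>x a y b. (x, a) \<in> G \<longrightarrow> (y, b) \<in> G \<longrightarrow> (x \<oplus>\<^bsub>Y\<^esub> y, a + b) \<in> G) \<and>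
     (\<forall>c x a. (x, a) \<in> G \<longrightarrow> (of_real c \<odot>\<^bsub>Y\<^esub> x, c * a) \<in> G) \<and>
     (\<forall>x a. (x, a) \<in> G \<longrightarrow> x \<in> carrier Y \<and> a \<le> C * vnorm Y x)"

lemma dominated_graph_unique:
  assumes G: "dominated_graph C G" and "(x, a) \<in> G" "(x, b) \<in> G"
  shows "a = b"
proof -
  have le: "a \<le> b" if "(x, a) \<in> G" "(x, b) \<in> G" for a b
  proof -
    have x: "x \<in> carrier Y" using that G by (auto simp: dominated_graph_def)
    have "(of_real (- 1) \<odot>\<^bsub>Y\<^esub> x, (- 1) * b) \<in> G"
      using that G unfolding dominated_graph_def by blast
    then have "(x \<oplus>\<^bsub>Y\<^esub> of_real (- 1) \<odot>\<^bsub>Y\<^esub> x, a + (- 1) * b) \<in> G"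
      using that G unfolding dominated_graph_def by blast
    moreover have "x \<oplus>\<^bsub>Y\<^esub> of_real (- 1) \<odot>\<^bsub>Y\<^esub> x = \<zero>\<^bsub>Y\<^esub>"
      using ns_minus_eq[OF x x] ns_minus_eq_zero_iff[OF x x] by simp
    ultimately have "a - b \<le> C * vnorm Y \<zero>\<^bsub>Y\<^esub>"
      using G unfolding dominated_graph_def by fastforce
    then show ?thesis by (simp add: ns_norm_zero)
  qed
  show ?thesis using le[of a b] le[of b a] assms by simp
qed

lemma dominated_graph_extend:
  assumes G: "dominated_graph C G" and C: "0 \<le> C" and w: "w \<in> carrier Y"
  shows "\<exists>c G'. dominated_graph C G' \<and> G \<subseteq> G' \<and> (w, c) \<in> G'"
proof -
  have G0: "(\<zero>\<^bsub>Y\<^esub>, 0) \<in> G"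
    and Ga: "\<And>x a y b. (x, a) \<in> G \<Longrightarrow> (y, b) \<in> G \<Longrightarrow> (x \<oplus>\<^bsub>Y\<^esub> y, a + b) \<in> G"
    and Gs: "\<And>c x a. (x, a) \<in> G \<Longrightarrow> (of_real c \<odot>\<^bsub>Y\<^esub> x, c * a) \<in> G"
    and Gc: "\<And>x a. (x, a) \<in> G \<Longrightarrow> x \<in> carrier Y"
    and Gn: "\<And>x a. (x, a) \<in> G \<Longrightarrow> a \<le> C * vnorm Y x"
    using G unfolding dominated_graph_def by blast+
  define L where "L = {a - C * vnorm Y (x \<ominus>\<^bsub>Y\<^esub> w) | x a. (x, a) \<in> G}"
  define c where "c = Sup L"
  have key: "a - C * vnorm Y (x \<ominus>\<^bsub>Y\<^esub> w) \<le> C * vnorm Y (y \<oplus>\<^bsub>Y\<^esub> w) - b"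
    if "(x, a) \<in> G" "(y, b) \<in> G" for x a y b
  proof -
    have xy: "x \<in> carrier Y" "y \<in> carrier Y" using that Gc by auto
    have "(x \<ominus>\<^bsub>Y\<^esub> w) \<oplus>\<^bsub>Y\<^esub> (y \<oplus>\<^bsub>Y\<^esub> w) = (x \<ominus>\<^bsub>Y\<^esub> w) \<oplus>\<^bsub>Y\<^esub> (w \<oplus>\<^bsub>Y\<^esub> y)"
      using xy w by (simp add: M.a_comm)
    also have "\<dots> = x \<oplus>\<^bsub>Y\<^esub> ((\<ominus>\<^bsub>Y\<^esub> w \<oplus>\<^bsub>Y\<^esub> w) \<oplus>\<^bsub>Y\<^esub> y)"
      using xy w by (simp add: a_minus_def M.a_assoc)
    also have "\<dots> = x \<oplus>\<^bsub>Y\<^esub> y" using xy w by (simp add: M.l_neg)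
    finally have "vnorm Y (x \<oplus>\<^bsub>Y\<^esub> y) \<le> vnorm Y (x \<ominus>\<^bsub>Y\<^esub> w) + vnorm Y (y \<oplus>\<^bsub>Y\<^esub> w)"
      using ns_norm_triangle[of "x \<ominus>\<^bsub>Y\<^esub> w" "y \<oplus>\<^bsub>Y\<^esub> w"] xy w by (simp add: ns_minus ns_add)
    then have "C * vnorm Y (x \<oplus>\<^bsub>Y\<^esub> y) \<le> C * vnorm Y (x \<ominus>\<^bsub>Y\<^esub> w) + C * vnorm Y (y \<oplus>\<^bsub>Y\<^esub> w)"
      using C by (metis mult_left_mono distrib_left)
    moreover have "a + b \<le> C * vnorm Y (x \<oplus>\<^bsub>Y\<^esub> y)" using Ga Gn that by blast
    ultimately show ?thesis by simp
  qed
  have Lne: "L \<noteq> {}" using G0 by (auto simp: L_def)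
  have upper: "c \<le> C * vnorm Y (y \<oplus>\<^bsub>Y\<^esub> w) - b" if "(y, b) \<in> G" for y b
    unfolding c_def using Lne by (rule cSup_least) (use key that in \<open>auto simp: L_def\<close>)
  have bdd: "bdd_above L"
    using key[OF _ G0] unfolding L_def bdd_above_def by blast
  have lower: "a - C * vnorm Y (x \<ominus>\<^bsub>Y\<^esub> w) \<le> c" if "(x, a) \<in> G" for x a
    unfolding c_def using bdd by (intro cSup_upper) (use that in \<open>auto simp: L_def\<close>)
  define G' where "G' = {(x \<oplus>\<^bsub>Y\<^esub> of_real t \<odot>\<^bsub>Y\<^esub> w, a + t * c) | x a t. (x, a) \<in> G}"
  have "dominated_graph C G'"
    unfolding dominated_graph_def
  proof (intro conjI allI impI)
    show "(\<zero>\<^bsub>Y\<^esub>, 0) \<in> G'"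
      unfolding G'_def using G0 w
      by (auto intro!: exI[of _ "\<zero>\<^bsub>Y\<^esub>"] exI[of _ "0::real"] simp: ns_scale_0)
  next
    fix x a y b assume "(x, a) \<in> G'" "(y, b) \<in> G'"
    then obtain x1 a1 t y1 b1 s where
      x: "x = x1 \<oplus>\<^bsub>Y\<^esub> of_real t \<odot>\<^bsub>Y\<^esub> w" "a = a1 + t * c" "(x1, a1) \<in> G" and
      y: "y = y1 \<oplus>\<^bsub>Y\<^esub> of_real s \<odot>\<^bsub>Y\<^esub> w" "b = b1 + s * c" "(y1, b1) \<in> G"
      unfolding G'_def by blast
    have "x \<oplus>\<^bsub>Y\<^esub> y = (x1 \<oplus>\<^bsub>Y\<^esub> y1) \<oplus>\<^bsub>Y\<^esub> of_real (t + s) \<odot>\<^bsub>Y\<^esub> w"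
      using Gc[OF x(3)] Gc[OF y(3)] w
      by (simp add: x(1) y(1) ns_add_scale ns_scale M.a_ac)
    moreover have "a + b = (a1 + b1) + (t + s) * c" by (simp add: x y algebra_simps)
    ultimately show "(x \<oplus>\<^bsub>Y\<^esub> y, a + b) \<in> G'"
      using Ga[OF x(3) y(3)] unfolding G'_def by blast
  next
    fix r x a assume "(x, a) \<in> G'"
    then obtain x1 a1 t where
      x: "x = x1 \<oplus>\<^bsub>Y\<^esub> of_real t \<odot>\<^bsub>Y\<^esub> w" "a = a1 + t * c" "(x1, a1) \<in> G"
      unfolding G'_def by blast
    have "of_real r \<odot>\<^bsub>Y\<^esub> x = of_real r \<odot>\<^bsub>Y\<^esub> x1 \<oplus>\<^bsub>Y\<^esub> of_real (r * t) \<odot>\<^bsub>Y\<^esub> w"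
      using Gc[OF x(3)] w by (simp add: x(1) ns_scale_add ns_scale_scale ns_scale)
    moreover have "r * a = r * a1 + (r * t) * c" by (simp add: x algebra_simps)
    ultimately show "(of_real r \<odot>\<^bsub>Y\<^esub> x, r * a) \<in> G'"
      using Gs[OF x(3)] unfolding G'_def by blast
  next
    fix x a assume "(x, a) \<in> G'"
    then obtain x1 a1 t where
      x: "x = x1 \<oplus>\<^bsub>Y\<^esub> of_real t \<odot>\<^bsub>Y\<^esub> w" "a = a1 + t * c" "(x1, a1) \<in> G"
      unfolding G'_def by blast
    have x1: "x1 \<in> carrier Y" using Gc x by blast
    show "x \<in> carrier Y" using x1 w by (simp add: x(1) ns_add ns_scale)
    have scaled: "(of_real (1 / \<bar>t\<bar>) \<odot>\<^bsub>Y\<^esub> x1, (1 / \<bar>t\<bar>) * a1) \<in> G" using Gs x by blast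
    consider "t = 0" | "t > 0" | "t < 0" by linarith
    then show "a \<le> C * vnorm Y x"
    proof cases
      case 1
      then show ?thesis using x x1 w Gn[OF x(3)] by (simp add: ns_scale_0)
    next
      case 2
      have "of_real t \<odot>\<^bsub>Y\<^esub> (of_real (1 / \<bar>t\<bar>) \<odot>\<^bsub>Y\<^esub> x1 \<oplus>\<^bsub>Y\<^esub> w) = x"
        using 2 x1 w by (simp add: x(1) ns_scale_add ns_scale ns_scale_scale ns_one)
      then have "vnorm Y x = t * vnorm Y (of_real (1 / \<bar>t\<bar>) \<odot>\<^bsub>Y\<^esub> x1 \<oplus>\<^bsub>Y\<^esub> w)"
        using ns_norm_scale[of "of_real (1 / \<bar>t\<bar>) \<odot>\<^bsub>Y\<^esub> x1 \<oplus>\<^bsub>Y\<^esub> w" "of_real t"] x1 w 2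
        by (simp add: ns_add ns_scale)
      moreover have "t * c \<le> t * (C * vnorm Y (of_real (1 / \<bar>t\<bar>) \<odot>\<^bsub>Y\<^esub> x1 \<oplus>\<^bsub>Y\<^esub> w) - (1 / \<bar>t\<bar>) * a1)"
        using upper[OF scaled] 2 by (intro mult_left_mono) auto
      ultimately show ?thesis using 2 by (simp add: x(2) algebra_simps)
    next
      case 3
      have "of_real (- t) \<odot>\<^bsub>Y\<^esub> (of_real (1 / \<bar>t\<bar>) \<odot>\<^bsub>Y\<^esub> x1 \<ominus>\<^bsub>Y\<^esub> w) = x"
        using 3 x1 w ns_one[OF x1]
        by (simp add: x(1) ns_minus_eq ns_scale_add ns_scale ns_scale_scale)
      then have "vnorm Y x = (- t) * vnorm Y (of_real (1 / \<bar>t\<bar>) \<odot>\<^bsub>Y\<^esub> x1 \<ominus>\<^bsub>Y\<^esub> w)"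
        using ns_norm_scale[of "of_real (1 / \<bar>t\<bar>) \<odot>\<^bsub>Y\<^esub> x1 \<ominus>\<^bsub>Y\<^esub> w" "of_real (- t)"] x1 w 3
        by (simp add: ns_minus ns_scale)
      moreover have "(- t) * ((1 / \<bar>t\<bar>) * a1 - C * vnorm Y (of_real (1 / \<bar>t\<bar>) \<odot>\<^bsub>Y\<^esub> x1 \<ominus>\<^bsub>Y\<^esub> w)) \<le> (- t) * c"
        using lower[OF scaled] 3 by (intro mult_left_mono) auto
      ultimately show ?thesis using 3 by (simp add: x(2) algebra_simps)
    qed
  qed
  moreover have "G \<subseteq> G'"
  proof safe
    fix x a assume xa: "(x, a) \<in> G"
    have "x = x \<oplus>\<^bsub>Y\<^esub> of_real 0 \<odot>\<^bsub>Y\<^esub> w" "a = a + 0 * c"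
      using Gc[OF xa] w by (auto simp: ns_scale_0)
    then show "(x, a) \<in> G'" using xa unfolding G'_def by blast
  qed
  moreover have "(w, c) \<in> G'"
  proof -
    have "w = \<zero>\<^bsub>Y\<^esub> \<oplus>\<^bsub>Y\<^esub> of_real 1 \<odot>\<^bsub>Y\<^esub> w" "c = 0 + 1 * c"
      using w by (auto simp: ns_one)
    then show ?thesis using G0 unfolding G'_def by blast
  qed
  ultimately show ?thesis by blast
qed

lemma dominated_graph_total:
  assumes G: "dominated_graph C G0" and C: "0 \<le> C"
  shows "\<exists>G. dominated_graph C G \<and> G0 \<subseteq> G \<and> (\<forall>y\<in>carrier Y. \<exists>a. (y, a) \<in> G)"
proof -
  define \<A> where "\<A> = {G. dominated_graph C G \<and> G0 \<subseteq> G}"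
  have "\<exists>M\<in>\<A>. \<forall>X\<in>\<A>. M \<subseteq> X \<longrightarrow> X = M"
  proof (rule subset_Zorn_nonempty)
    show "\<A> \<noteq> {}" using G by (auto simp: \<A>_def)
    fix \<C> assume ne: "\<C> \<noteq> {}" and ch: "subset.chain \<A> \<C>"
    then have sub: "\<And>G. G \<in> \<C> \<Longrightarrow> dominated_graph C G \<and> G0 \<subseteq> G"
      by (auto simp: \<A>_def subset.chain_def)
    have tot: "\<And>G H. G \<in> \<C> \<Longrightarrow> H \<in> \<C> \<Longrightarrow> G \<subseteq> H \<or> H \<subseteq> G"
      using ch by (auto simp: subset_chain_def)
    have "dominated_graph C (\<Union>\<C>)"
      unfolding dominated_graph_def
    proof (intro conjI allI impI)
      show "(\<zero>\<^bsub>Y\<^esub>, 0) \<in> \<Union>\<C>" using ne sub unfolding dominated_graph_def by blast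
    next
      fix x a y b assume "(x, a) \<in> \<Union>\<C>" "(y, b) \<in> \<Union>\<C>"
      then obtain G where "G \<in> \<C>" "(x, a) \<in> G" "(y, b) \<in> G" using tot by blast
      then show "(x \<oplus>\<^bsub>Y\<^esub> y, a + b) \<in> \<Union>\<C>" using sub unfolding dominated_graph_def by blast
    qed (use sub in \<open>unfold dominated_graph_def, blast+\<close>)
    then show "\<Union>\<C> \<in> \<A>" using sub ne unfolding \<A>_def by blast
  qed
  then obtain M where "M \<in> \<A>" and "\<forall>X\<in>\<A>. M \<subseteq> X \<longrightarrow> X = M" by blast
  then have M: "dominated_graph C M" "G0 \<subseteq> M"
    and max: "\<And>H. dominated_graph C H \<Longrightarrow> M \<subseteq> H \<Longrightarrow> H = M"
    by (auto simp: \<A>_def)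
  have "\<exists>a. (y, a) \<in> M" if y: "y \<in> carrier Y" for y
  proof -
    obtain c H where H: "dominated_graph C H" "M \<subseteq> H" "(y, c) \<in> H"
      using dominated_graph_extend[OF M(1) C y] by blast
    then show ?thesis using max[OF H(1,2)] by blast
  qed
  then show ?thesis using M by blast
qed

lemma hahn_banach_real:
  assumes Z: "Z \<subseteq> carrier Y" "\<zero>\<^bsub>Y\<^esub> \<in> Z" "\<And>x y. x \<in> Z \<Longrightarrow> y \<in> Z \<Longrightarrow> x \<oplus>\<^bsub>Y\<^esub> y \<in> Z"
      "\<And>c x. x \<in> Z \<Longrightarrow> of_real c \<odot>\<^bsub>Y\<^esub> x \<in> Z"
    and g: "\<And>x y. x \<in> Z \<Longrightarrow> y \<in> Z \<Longrightarrow> g (x \<oplus>\<^bsub>Y\<^esub> y) = g x + g y"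
      "\<And>c x. x \<in> Z \<Longrightarrow> g (of_real c \<odot>\<^bsub>Y\<^esub> x) = c * g x"
      "\<And>x. x \<in> Z \<Longrightarrow> g x \<le> C * vnorm Y x"
    and C: "0 \<le> C"
  obtains h :: "'a \<Rightarrow> real" where "\<And>x. x \<in> Z \<Longrightarrow> h x = g x"
    "\<And>x y. x \<in> carrier Y \<Longrightarrow> y \<in> carrier Y \<Longrightarrow> h (x \<oplus>\<^bsub>Y\<^esub> y) = h x + h y"
    "\<And>c x. x \<in> carrier Y \<Longrightarrow> h (of_real c \<odot>\<^bsub>Y\<^esub> x) = c * h x"
    "\<And>x. x \<in> carrier Y \<Longrightarrow> h x \<le> C * vnorm Y x"
proof -
  have "g \<zero>\<^bsub>Y\<^esub> = 0" using g(2)[OF Z(2), of 0] Z by (simp add: ns_scale_0 ns_zero)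
  then have "dominated_graph C {(x, g x) | x. x \<in> Z}"
    using Z g unfolding dominated_graph_def by (auto simp: subset_iff)
  from dominated_graph_total[OF this C] obtain G where
    G: "dominated_graph C G" "{(x, g x) | x. x \<in> Z} \<subseteq> G" and tot: "\<And>y. y \<in> carrier Y \<Longrightarrow> \<exists>a. (y, a) \<in> G"
    by blast
  define h where "h x = (THE a. (x, a) \<in> G)" for x
  have hG: "h x = a" if "(x, a) \<in> G" for x a
    unfolding h_def using that dominated_graph_unique[OF G(1)] by blast
  have Ga: "\<And>x a y b. (x, a) \<in> G \<Longrightarrow> (y, b) \<in> G \<Longrightarrow> (x \<oplus>\<^bsub>Y\<^esub> y, a + b) \<in> G"
    and Gs: "\<And>c x a. (x, a) \<in> G \<Longrightarrow> (of_real c \<odot>\<^bsub>Y\<^esub> x, c * a) \<in> G"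
    and Gn: "\<And>x a. (x, a) \<in> G \<Longrightarrow> a \<le> C * vnorm Y x"
    using G(1) unfolding dominated_graph_def by blast+
  have Gh: "(x, h x) \<in> G" if "x \<in> carrier Y" for x using tot[OF that] hG by blast
  show ?thesis
  proof (rule that[of h])
    show "h x = g x" if "x \<in> Z" for x using hG G(2) that by blast
    show "h (x \<oplus>\<^bsub>Y\<^esub> y) = h x + h y" if "x \<in> carrier Y" "y \<in> carrier Y" for x y
      by (rule hG[OF Ga[OF Gh[OF that(1)] Gh[OF that(2)]]])
    show "h (of_real c \<odot>\<^bsub>Y\<^esub> x) = c * h x" if "x \<in> carrier Y" for c x
      by (rule hG[OF Gs[OF Gh[OF that]]])
    show "h x \<le> C * vnorm Y x" if "x \<in> carrier Y" for x
      by (rule Gn[OF Gh[OF that]])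
  qed
qed

end

lemma scalar_real_part:
  obtains re :: "'k::real_or_complex \<Rightarrow> real" where
    "\<And>x y. re (x + y) = re x + re y" "\<And>c x. re (of_real c * x) = c * re x"
    "\<And>x. re x \<le> norm x" "\<And>c. re (of_real c) = c"
    "\<forall>\<phi>. (\<forall>x y. \<phi> (x + y) = \<phi> x + \<phi> y) \<and> (\<forall>c x. \<phi> (of_real c * x) = c * \<phi> x) \<longrightarrow>
       (\<exists>w. \<forall>a. \<phi> a = re (a * w))"
  using real_or_complex[where 'a = 'k]
proof (elim disjE exE conjE)
  assume "\<forall>z::'k. \<exists>a. z = a *\<^sub>R 1"
  then obtain re :: "'k \<Rightarrow> real" where re: "\<And>z. of_real (re z) = z"
    unfolding of_real_def by metis
  have inj: "re z = a" if "z = of_real a" for z a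
    using re[of z] that by simp
  show thesis
  proof (rule that[of re])
    show "re (x + y) = re x + re y" for x y by (rule inj) (simp add: re)
    show "re (of_real c * x) = c * re x" for c x by (rule inj) (simp add: re)
    show "re x \<le> norm x" for x by (subst (2) re[symmetric]) simp
    show "re (of_real c) = c" for c by (rule inj) simp
    show "\<forall>\<phi>. (\<forall>x y. \<phi> (x + y) = \<phi> x + \<phi> y) \<and> (\<forall>c x. \<phi> (of_real c * x) = c * \<phi> x) \<longrightarrow>
       (\<exists>w. \<forall>a. \<phi> a = re (a * w))"
    proof (intro allI impI, elim conjE)
      fix \<phi> :: "'k \<Rightarrow> real" assume s: "\<forall>c x. \<phi> (of_real c * x) = c * \<phi> x"
      have "\<phi> a = re (a * of_real (\<phi> 1))" for a
        using s[rule_format, of "re a" 1] by (intro inj[symmetric]) (simp add: re)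
      then show "\<exists>w. \<forall>a. \<phi> a = re (a * w)" by blast
    qed
  qed
next
  fix i :: 'k
  assume ii: "i * i = - 1" and ex: "\<forall>z::'k. \<exists>a b. z = a *\<^sub>R 1 + b *\<^sub>R i"
    and norm: "\<forall>a b. norm (a *\<^sub>R 1 + b *\<^sub>R i) = sqrt (a\<^sup>2 + b\<^sup>2)"
  from ex obtain re im :: "'k \<Rightarrow> real" where z: "\<And>z. z = of_real (re z) + of_real (im z) * i"
    unfolding of_real_def mult_scaleR_left mult_1 by metis
  have nz: "norm (of_real a + of_real b * i) = sqrt (a\<^sup>2 + b\<^sup>2)" for a b
    using norm by (simp add: of_real_def)
  have inj: "re w = a" if "w = of_real a + of_real b * i" for w a b
  proof -
    have "of_real (re w - a) + of_real (im w - b) * i = 0"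
      using z[of w] that by (simp add: algebra_simps)
    then have "sqrt ((re w - a)\<^sup>2 + (im w - b)\<^sup>2) = 0" using nz[of "re w - a" "im w - b"] by simp
    then show ?thesis by simp
  qed
  show thesis
  proof (rule that[of re])
    show "re (x + y) = re x + re y" for x y
      by (rule inj[of _ _ "im x + im y"], subst z[of x], subst z[of y]) (simp add: algebra_simps)
    show "re (of_real c * x) = c * re x" for c x
      by (rule inj[of _ _ "c * im x"], subst z[of x]) (simp add: algebra_simps)
    show "re x \<le> norm x" for x
      by (subst (2) z[of x], subst nz) (simp add: real_le_rsqrt)
    show "re (of_real c) = c" for c by (rule inj[of _ _ 0]) simp
    show "\<forall>\<phi>. (\<forall>x y. \<phi> (x + y) = \<phi> x + \<phi> y) \<and> (\<forall>c x. \<phi> (of_real c * x) = c * \<phi> x) \<longrightarrow>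
       (\<exists>w. \<forall>a. \<phi> a = re (a * w))"
    proof (intro allI impI, elim conjE)
      fix \<phi> :: "'k \<Rightarrow> real"
      assume a: "\<forall>x y. \<phi> (x + y) = \<phi> x + \<phi> y" and s: "\<forall>c x. \<phi> (of_real c * x) = c * \<phi> x"
      have "\<phi> x = re (x * (of_real (\<phi> 1) - of_real (\<phi> i) * i))" for x
      proof -
        have "\<phi> x = re x * \<phi> 1 + im x * \<phi> i"
          using a[rule_format, of "of_real (re x)" "of_real (im x) * i"] s[rule_format, of "re x" 1] s[rule_format, of "im x" i] z[of x]
          by simp
        moreover have "x * (of_real (\<phi> 1) - of_real (\<phi> i) * i) =
          of_real (re x * \<phi> 1) + of_real (im x * \<phi> 1) * i - of_real (re x * \<phi> i) * i
            - of_real (im x * \<phi> i) * (i * i)"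
          by (subst z[of x]) (simp add: algebra_simps)
        then have eq: "x * (of_real (\<phi> 1) - of_real (\<phi> i) * i) =
          of_real (re x * \<phi> 1 + im x * \<phi> i) + of_real (im x * \<phi> 1 - re x * \<phi> i) * i"
          unfolding ii by (simp add: algebra_simps)
        ultimately show ?thesis using inj[OF eq] by simp
      qed
      then show "\<exists>w. \<forall>a. \<phi> a = re (a * w)" by blast
    qed
  qed
qed

theorem hahn_banach:
  fixes Y :: "('k::real_or_complex, 'a) normed_space"
  assumes ns: "is_normed_space Y"
    and Z: "Z \<subseteq> carrier Y" "\<zero>\<^bsub>Y\<^esub> \<in> Z" "\<And>x y. x \<in> Z \<Longrightarrow> y \<in> Z \<Longrightarrow> x \<oplus>\<^bsub>Y\<^esub> y \<in> Z"
      "\<And>c x. x \<in> Z \<Longrightarrow> c \<odot>\<^bsub>Y\<^esub> x \<in> Z"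
    and f: "\<And>x y. x \<in> Z \<Longrightarrow> y \<in> Z \<Longrightarrow> f (x \<oplus>\<^bsub>Y\<^esub> y) = f x + f y"
      "\<And>c x. x \<in> Z \<Longrightarrow> f (c \<odot>\<^bsub>Y\<^esub> x) = c * f x"
      "\<And>x. x \<in> Z \<Longrightarrow> norm (f x) \<le> C * vnorm Y x"
    and C: "0 \<le> C"
  obtains F where "F \<in> dual Y" "\<And>x. x \<in> Z \<Longrightarrow> F x = f x"
    "\<And>x. x \<in> carrier Y \<Longrightarrow> norm (F x) \<le> C * vnorm Y x"
proof -
  obtain re :: "'k \<Rightarrow> real" where
    re_add: "\<And>x y. re (x + y) = re x + re y" and re_scale: "\<And>c x. re (of_real c * x) = c * re x"
    and re_le: "\<And>x. re x \<le> norm x" and re_of_real: "\<And>c. re (of_real c) = c"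
    and rep: "\<forall>\<phi>. (\<forall>x y. \<phi> (x + y) = \<phi> x + \<phi> y) \<and> (\<forall>c x. \<phi> (of_real c * x) = c * \<phi> x) \<longrightarrow>
       (\<exists>w. \<forall>a. \<phi> a = re (a * w))"
    by (rule scalar_real_part[where 'k = 'k], rule that) assumption+
  have re_eqI: "v = w" if "\<And>a. re (a * v) = re (a * w)" for v w
  proof (rule ccontr)
    assume "v \<noteq> w"
    define a where "a = of_real (norm (v - w)) / (v - w)"
    have "re (a * v) = re (a * w) + re (a * (v - w))"
      by (simp add: re_add[symmetric] algebra_simps)
    moreover have "a * (v - w) = of_real (norm (v - w))" using \<open>v \<noteq> w\<close> by (simp add: a_def)
    ultimately show False using that[of a] \<open>v \<noteq> w\<close> by (simp add: re_of_real)
  qed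
  note ns_rules = ns_add[OF ns] ns_scale[OF ns] ns_scale_scale[OF ns] ns_scale_add[OF ns]
    ns_add_scale[OF ns]
  obtain h where h_eq: "\<And>x. x \<in> Z \<Longrightarrow> h x = re (f x)"
    and h_add: "\<And>x y. x \<in> carrier Y \<Longrightarrow> y \<in> carrier Y \<Longrightarrow> h (x \<oplus>\<^bsub>Y\<^esub> y) = h x + h y"
    and h_scale: "\<And>c x. x \<in> carrier Y \<Longrightarrow> h (of_real c \<odot>\<^bsub>Y\<^esub> x) = c * h x"
    and h_le: "\<And>x. x \<in> carrier Y \<Longrightarrow> h x \<le> C * vnorm Y x"
  proof (rule hahn_banach_real[OF ns Z(1-3), of "\<lambda>x. re (f x)" C])
    show "re (f x) \<le> C * vnorm Y x" if "x \<in> Z" for x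
      using re_le[of "f x"] f(3)[OF that] by linarith
  qed (use Z f C in \<open>auto simp: re_add re_scale\<close>)
  have "\<exists>w. \<forall>a. h (a \<odot>\<^bsub>Y\<^esub> x) = re (a * w)" if "x \<in> carrier Y" for x
  proof (rule rep[rule_format], intro conjI allI)
    show "h ((a + b) \<odot>\<^bsub>Y\<^esub> x) = h (a \<odot>\<^bsub>Y\<^esub> x) + h (b \<odot>\<^bsub>Y\<^esub> x)" for a b
      using that by (simp add: ns_rules h_add)
    show "h ((of_real c * a) \<odot>\<^bsub>Y\<^esub> x) = c * h (a \<odot>\<^bsub>Y\<^esub> x)" for c a
      using h_scale[of "a \<odot>\<^bsub>Y\<^esub> x" c] that by (simp add: ns_rules)
  qed
  then obtain F where F: "\<And>x a. x \<in> carrier Y \<Longrightarrow> re (a * F x) = h (a \<odot>\<^bsub>Y\<^esub> x)" by metis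
  have F_add: "F (x \<oplus>\<^bsub>Y\<^esub> y) = F x + F y" if "x \<in> carrier Y" "y \<in> carrier Y" for x y
    by (rule re_eqI) (use that in \<open>simp add: F ns_rules h_add re_add distrib_left\<close>)
  have F_scale: "F (c \<odot>\<^bsub>Y\<^esub> x) = c * F x" if "x \<in> carrier Y" for c x
  proof (rule re_eqI)
    fix a
    have "re (a * (c * F x)) = h ((a * c) \<odot>\<^bsub>Y\<^esub> x)"
      using F[OF that, of "a * c"] by (simp add: mult.assoc)
    then show "re (a * F (c \<odot>\<^bsub>Y\<^esub> x)) = re (a * (c * F x))" using that by (simp add: F ns_rules)
  qed
  have F_eq: "F x = f x" if "x \<in> Z" for x
  proof (rule re_eqI)
    show "re (a * F x) = re (a * f x)" for a
      using that Z(1) Z(4)[OF that, of a] f(2)[OF that, of a] by (auto simp: F h_eq)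
  qed
  have F_le: "norm (F x) \<le> C * vnorm Y x" if x: "x \<in> carrier Y" for x
  proof (cases "F x = 0")
    case True
    then show ?thesis using C ns_norm_ge[OF ns x] by simp
  next
    case False
    define u where "u = of_real (norm (F x)) / F x"
    have "norm u = 1" using False by (simp add: u_def norm_divide)
    have "norm (F x) = re (u * F x)" using False by (simp add: u_def re_of_real)
    also have "\<dots> = h (u \<odot>\<^bsub>Y\<^esub> x)" using x by (rule F)
    also have "\<dots> \<le> C * vnorm Y (u \<odot>\<^bsub>Y\<^esub> x)" using x by (simp add: h_le ns_rules)
    also have "\<dots> = C * vnorm Y x" using \<open>norm u = 1\<close> x by (simp add: ns_norm_scale[OF ns])
    finally show ?thesis .
  qed
  have "F \<in> dual Y"
    using F_add F_scale F_le by (auto simp: dual_def bounded_operator_def intro!: exI[of _ C])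
  then show ?thesis using F_eq F_le by (rule that)
qed

lemma dualD:
  assumes "f \<in> dual Y"
  shows "\<And>x y. x \<in> carrier Y \<Longrightarrow> y \<in> carrier Y \<Longrightarrow> f (x \<oplus>\<^bsub>Y\<^esub> y) = f x + f y"
    and "\<And>c x. x \<in> carrier Y \<Longrightarrow> f (c \<odot>\<^bsub>Y\<^esub> x) = c * f x"
    and "\<exists>C. \<forall>x\<in>carrier Y. norm (f x) \<le> C * vnorm Y x"
  using assms by (auto simp: dual_def bounded_operator_def)

lemma dualI:
  assumes "\<And>x y. x \<in> carrier Y \<Longrightarrow> y \<in> carrier Y \<Longrightarrow> f (x \<oplus>\<^bsub>Y\<^esub> y) = f x + f y"
    and "\<And>c x. x \<in> carrier Y \<Longrightarrow> f (c \<odot>\<^bsub>Y\<^esub> x) = c * f x"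
    and "\<And>x. x \<in> carrier Y \<Longrightarrow> norm (f x) \<le> C * vnorm Y x"
  shows "f \<in> dual Y"
  using assms by (auto simp: dual_def bounded_operator_def intro!: exI[of _ C])

lemma zero_in_unit_ball: "is_normed_space Y \<Longrightarrow> \<zero>\<^bsub>Y\<^esub> \<in> unit_ball Y"
  by (simp add: unit_ball_def ns_zero ns_norm_zero)

lemma dual_norm_bound:
  assumes ns: "is_normed_space Y" and f: "f \<in> dual Y"
  shows "0 \<le> dual_norm Y f"
    and "x \<in> carrier Y \<Longrightarrow> norm (f x) \<le> dual_norm Y f * vnorm Y x"
proof -
  obtain C where C: "\<And>x. x \<in> carrier Y \<Longrightarrow> norm (f x) \<le> C * vnorm Y x"
    using dualD(3)[OF f] by blast
  have "norm (f x) \<le> \<bar>C\<bar>" if "x \<in> unit_ball Y" for x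
  proof -
    have x: "x \<in> carrier Y" "vnorm Y x \<le> 1" using that by (auto simp: unit_ball_def)
    have "C * vnorm Y x \<le> \<bar>C\<bar> * vnorm Y x"
      using ns_norm_ge[OF ns x(1)] by (intro mult_right_mono) auto
    also have "\<dots> \<le> \<bar>C\<bar>" using x(2) by (simp add: mult_left_le)
    finally show ?thesis using C[OF x(1)] by simp
  qed
  then have bdd: "bdd_above ((\<lambda>x. norm (f x)) ` unit_ball Y)" by (auto intro!: bdd_aboveI)
  have le: "norm (f x) \<le> dual_norm Y f" if "x \<in> unit_ball Y" for x
    unfolding dual_norm_def using that bdd by (rule cSUP_upper)
  show "0 \<le> dual_norm Y f"
    using le[OF zero_in_unit_ball[OF ns]] norm_ge_zero order_trans by blast
  assume x: "x \<in> carrier Y"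
  show "norm (f x) \<le> dual_norm Y f * vnorm Y x"
  proof (cases "vnorm Y x = 0")
    case True
    then show ?thesis using C[OF x] by simp
  next
    case False
    then have pos: "vnorm Y x > 0" using ns_norm_ge[OF ns x] by simp
    have "of_real (1 / vnorm Y x) \<odot>\<^bsub>Y\<^esub> x \<in> unit_ball Y"
      using x pos ns_norm_scale[OF ns x, of "of_real (1 / vnorm Y x)"]
      by (simp add: unit_ball_def ns_scale[OF ns] norm_divide)
    from le[OF this] have "norm (of_real (1 / vnorm Y x) * f x) \<le> dual_norm Y f"
      using dualD(2)[OF f x] by simp
    then show ?thesis using pos by (simp add: norm_mult norm_divide field_simps)
  qed
qed

lemma dual_norm_le:
  assumes ns: "is_normed_space Y" and "0 \<le> C"
    and "\<And>x. x \<in> carrier Y \<Longrightarrow> norm (f x) \<le> C * vnorm Y x"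
  shows "dual_norm Y f \<le> C"
  unfolding dual_norm_def
proof (rule cSUP_least)
  show "unit_ball Y \<noteq> {}" using zero_in_unit_ball[OF ns] by blast
  show "norm (f x) \<le> C" if "x \<in> unit_ball Y" for x
    using assms(3)[of x] that mult_left_mono[of "vnorm Y x" 1 C] \<open>0 \<le> C\<close>
    by (auto simp: unit_ball_def)
qed

lemma zero_in_dual_ball: "is_normed_space Y \<Longrightarrow> (\<lambda>x. 0) \<in> dual_ball Y"
  using dual_norm_le[of Y 0 "\<lambda>x. 0"] dualI[of Y "\<lambda>x. 0" 0] by (simp add: dual_ball_def)

lemma topspace_weak_topology [simp]: "topspace (weak_topology Y) = carrier Y"
proof -
  have "(\<lambda>x. 0) \<in> dual Y" by (rule dualI[of _ _ 0]) auto
  then have "\<exists>f U. carrier Y = {x \<in> carrier Y. f x \<in> U} \<and> f \<in> dual Y \<and> open U"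
    by (intro exI[of _ "\<lambda>x. 0"] exI[of _ UNIV]) auto
  then show ?thesis unfolding weak_topology_def topology_generated_by_topspace by blast
qed

lemma openin_weak_topology:
  "f \<in> dual Y \<Longrightarrow> open U \<Longrightarrow> openin (weak_topology Y) {x \<in> carrier Y. f x \<in> U}"
  unfolding weak_topology_def by (rule topology_generated_by_Basis) blast

lemma dual_separates:
  fixes Y :: "('k::real_or_complex, 'a) normed_space"
  assumes ns: "is_normed_space Y" and xy: "x \<in> carrier Y" "y \<in> carrier Y" "x \<noteq> y"
  obtains f where "f \<in> dual Y" "f x \<noteq> f y"
proof -
  define w where "w = x \<ominus>\<^bsub>Y\<^esub> y"
  have w: "w \<in> carrier Y" using xy by (simp add: w_def ns_minus[OF ns])
  have w0: "vnorm Y w \<noteq> 0" using ns_eq_iff[OF ns xy(1,2)] xy(3) by (simp add: w_def)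
  define Z where "Z = range (\<lambda>a. a \<odot>\<^bsub>Y\<^esub> w)"
  have inj: "a = b" if "a \<odot>\<^bsub>Y\<^esub> w = b \<odot>\<^bsub>Y\<^esub> w" for a b
  proof -
    have "a \<odot>\<^bsub>Y\<^esub> w \<ominus>\<^bsub>Y\<^esub> b \<odot>\<^bsub>Y\<^esub> w = (a + - 1 * b) \<odot>\<^bsub>Y\<^esub> w"
      using w by (simp only: ns_minus_eq[OF ns] ns_scale[OF ns] ns_scale_scale[OF ns] ns_add_scale[OF ns])
    then have "vnorm Y ((a + - 1 * b) \<odot>\<^bsub>Y\<^esub> w) = 0"
      using that ns_eq_iff[OF ns ns_scale[OF ns w] ns_scale[OF ns w], of a b] by simp
    then show ?thesis using w0 by (simp add: ns_norm_scale[OF ns w])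
  qed
  define f where "f = (\<lambda>z. THE a. z = a \<odot>\<^bsub>Y\<^esub> w)"
  have f: "f (a \<odot>\<^bsub>Y\<^esub> w) = a" for a unfolding f_def using inj by blast
  obtain F where F: "F \<in> dual Y" "\<And>z. z \<in> Z \<Longrightarrow> F z = f z"
  proof (rule hahn_banach[OF ns, of Z f "1 / vnorm Y w"])
    show "Z \<subseteq> carrier Y" using w by (auto simp: Z_def ns_scale[OF ns])
    show "\<zero>\<^bsub>Y\<^esub> \<in> Z" unfolding Z_def using ns_scale_0[OF ns w] by (metis rangeI)
    show "x \<oplus>\<^bsub>Y\<^esub> y \<in> Z" "f (x \<oplus>\<^bsub>Y\<^esub> y) = f x + f y" if "x \<in> Z" "y \<in> Z" for x y
      using that w by (auto simp: Z_def f ns_add_scale[OF ns, symmetric])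
    show "c \<odot>\<^bsub>Y\<^esub> x \<in> Z" "f (c \<odot>\<^bsub>Y\<^esub> x) = c * f x" if "x \<in> Z" for c x
      using that w by (auto simp: Z_def f ns_scale_scale[OF ns])
    show "norm (f x) \<le> 1 / vnorm Y w * vnorm Y x" if "x \<in> Z" for x
      using that w w0 by (auto simp: Z_def f ns_norm_scale[OF ns])
    show "0 \<le> 1 / vnorm Y w" using ns_norm_ge[OF ns w] by simp
  qed blast
  have "F (1 \<odot>\<^bsub>Y\<^esub> w) = 1" using F(2)[of "1 \<odot>\<^bsub>Y\<^esub> w"] by (simp add: Z_def f)
  then have "F w = 1" using w by (simp add: ns_one[OF ns])
  moreover have "F w = F x - F y"
    using xy by (simp add: w_def ns_minus_eq[OF ns] dualD[OF F(1)] ns_scale[OF ns])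
  ultimately have "F x \<noteq> F y" by auto
  then show ?thesis by (rule that[OF F(1)])
qed

lemma Hausdorff_weak_topology:
  assumes ns: "is_normed_space Y"
  shows "Hausdorff_space (weak_topology Y)"
  unfolding Hausdorff_space_def
proof (intro allI impI, elim conjE)
  fix x y assume "x \<in> topspace (weak_topology Y)" "y \<in> topspace (weak_topology Y)" "x \<noteq> y"
  then have xy: "x \<in> carrier Y" "y \<in> carrier Y" "x \<noteq> y" by auto
  obtain f where f: "f \<in> dual Y" "f x \<noteq> f y"
    by (rule dual_separates[OF ns xy])
  obtain U V where "open U" "open V" "f x \<in> U" "f y \<in> V" "U \<inter> V = {}"
    using separation_t2[THEN iffD1, OF f(2)] by blast
  then show "\<exists>U V. openin (weak_topology Y) U \<and> openin (weak_topology Y) V \<and> x \<in> U \<and> y \<in> V \<and> disjnt U V"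
    using xy f(1)
    by (intro exI[of _ "{x \<in> carrier Y. f x \<in> U}"] exI[of _ "{x \<in> carrier Y. f x \<in> V}"])
      (auto simp: openin_weak_topology disjnt_def)
qed

text \<open>Transport of the structure of a subspace \<open>W\<close> of \<open>Y\<close> along a map \<open>\<phi>\<close> injective on \<open>W\<close>.\<close>

definition transported ::
  "('k::real_or_complex, 'a) normed_space \<Rightarrow> 'a set \<Rightarrow> ('a \<Rightarrow> 'b) \<Rightarrow> ('k, 'b) normed_space" where
  "transported Y W \<phi> =
     \<lparr>carrier = \<phi> ` W, monoid.mult = undefined, one = undefined, zero = \<phi> \<zero>\<^bsub>Y\<^esub>,
      add = (\<lambda>u v. \<phi> (inv_into W \<phi> u \<oplus>\<^bsub>Y\<^esub> inv_into W \<phi> v)),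
      smult = (\<lambda>a u. \<phi> (a \<odot>\<^bsub>Y\<^esub> inv_into W \<phi> u)), vnorm = (\<lambda>u. vnorm Y (inv_into W \<phi> u))\<rparr>"

definition closed_subspace :: "('k::real_or_complex, 'a) normed_space \<Rightarrow> 'a set \<Rightarrow> bool" where
  "closed_subspace Y W \<longleftrightarrow> W \<subseteq> carrier Y \<and> \<zero>\<^bsub>Y\<^esub> \<in> W \<and>
     (\<forall>x\<in>W. \<forall>y\<in>W. x \<oplus>\<^bsub>Y\<^esub> y \<in> W) \<and> (\<forall>c. \<forall>x\<in>W. c \<odot>\<^bsub>Y\<^esub> x \<in> W) \<and>
     (\<forall>s y. (\<forall>n. s n \<in> W) \<longrightarrow> y \<in> carrier Y \<longrightarrow> (\<lambda>n. vnorm Y (s n \<ominus>\<^bsub>Y\<^esub> y)) \<longlonglongrightarrow> 0 \<longrightarrow> y \<in> W)"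

context
  fixes Y :: "('k::real_or_complex, 'a) normed_space" and W :: "'a set" and \<phi> :: "'a \<Rightarrow> 'b"
  assumes ban: "is_banach_space Y"
    and sub: "closed_subspace Y W"
    and inj: "inj_on \<phi> W"
begin

private abbreviation (input) "Z \<equiv> transported Y W \<phi>"

private lemma ns_of_banach: "is_normed_space Y"
  using ban by (simp add: is_banach_space_def)

private lemmas ns = ns_of_banach

private lemma W: "W \<subseteq> carrier Y" "\<zero>\<^bsub>Y\<^esub> \<in> W" "\<And>x y. x \<in> W \<Longrightarrow> y \<in> W \<Longrightarrow> x \<oplus>\<^bsub>Y\<^esub> y \<in> W"
    "\<And>c x. x \<in> W \<Longrightarrow> c \<odot>\<^bsub>Y\<^esub> x \<in> W"
  using sub unfolding closed_subspace_def by simp_all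

private lemma W_closed: "(\<And>n. s n \<in> W) \<Longrightarrow> y \<in> carrier Y \<Longrightarrow>
      (\<lambda>n. vnorm Y (s n \<ominus>\<^bsub>Y\<^esub> y)) \<longlonglongrightarrow> 0 \<Longrightarrow> y \<in> W"
  by (rule sub[unfolded closed_subspace_def, THEN conjunct2, THEN conjunct2, THEN conjunct2,
        THEN conjunct2, rule_format])

private lemma Wc: "x \<in> W \<Longrightarrow> x \<in> carrier Y" using W(1) by blast

lemma transported_simps:
  "carrier Z = \<phi> ` W" "\<zero>\<^bsub>Z\<^esub> = \<phi> \<zero>\<^bsub>Y\<^esub>"
  "x \<in> W \<Longrightarrow> y \<in> W \<Longrightarrow> \<phi> x \<oplus>\<^bsub>Z\<^esub> \<phi> y = \<phi> (x \<oplus>\<^bsub>Y\<^esub> y)"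
  "x \<in> W \<Longrightarrow> a \<odot>\<^bsub>Z\<^esub> \<phi> x = \<phi> (a \<odot>\<^bsub>Y\<^esub> x)"
  "x \<in> W \<Longrightarrow> vnorm Z (\<phi> x) = vnorm Y x"
  using inj by (simp_all add: transported_def)

lemma transported_normed: "is_normed_space Z"
proof -
  interpret Y: module "scalar_field :: ('k, 'k) normed_space" Y
    using ns by (simp add: is_normed_space_def)
  have "abelian_group Z"
  proof (rule abelian_groupI)
    show "\<exists>y\<in>carrier Z. y \<oplus>\<^bsub>Z\<^esub> x = \<zero>\<^bsub>Z\<^esub>" if x: "x \<in> carrier Z" for x
    proof -
      obtain w where w: "w \<in> W" "x = \<phi> w" using x by (auto simp: transported_simps)
      have "(- 1) \<odot>\<^bsub>Y\<^esub> w \<oplus>\<^bsub>Y\<^esub> w = (- 1 + 1) \<odot>\<^bsub>Y\<^esub> w"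
        using w(1) Wc by (simp only: ns_add_scale[OF ns] ns_one[OF ns])
      then have "(- 1) \<odot>\<^bsub>Y\<^esub> w \<oplus>\<^bsub>Y\<^esub> w = \<zero>\<^bsub>Y\<^esub>" using w(1) Wc by (simp add: ns_scale_0[OF ns])
      then show ?thesis
        using w W by (intro bexI[of _ "\<phi> ((- 1) \<odot>\<^bsub>Y\<^esub> w)"]) (auto simp: transported_simps)
    qed
  qed (use W in \<open>auto simp: transported_simps Wc Y.M.a_ac\<close>)
  then have "module (scalar_field :: ('k, 'k) normed_space) Z"
    using W by (intro moduleI cring_scalar_field)
      (auto simp: transported_simps Wc ns_scale_add[OF ns] ns_add_scale[OF ns] ns_scale_scale[OF ns]
        ns_one[OF ns])
  moreover have "\<phi> x = \<phi> \<zero>\<^bsub>Y\<^esub> \<longleftrightarrow> x = \<zero>\<^bsub>Y\<^esub>" if "x \<in> W" for x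
    using that inj W(2) by (auto dest: inj_onD)
  ultimately show ?thesis
    using W unfolding is_normed_space_def
    by (auto simp: transported_simps Wc ns_norm_ge[OF ns] ns_norm_eq[OF ns] ns_norm_scale[OF ns]
      ns_norm_triangle[OF ns])
qed

lemma transported_minus: "x \<in> W \<Longrightarrow> y \<in> W \<Longrightarrow> \<phi> x \<ominus>\<^bsub>Z\<^esub> \<phi> y = \<phi> (x \<ominus>\<^bsub>Y\<^esub> y)"
  and W_minus: "x \<in> W \<Longrightarrow> y \<in> W \<Longrightarrow> x \<ominus>\<^bsub>Y\<^esub> y \<in> W"
  by (simp_all add: ns_minus_eq[OF transported_normed] ns_minus_eq[OF ns] transported_simps Wc
      W(3) W(4))

lemma transported_banach: "is_banach_space Z"
  unfolding is_banach_space_def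
proof (intro conjI transported_normed allI impI, elim conjE)
  fix u :: "nat \<Rightarrow> 'b"
  assume u: "\<forall>n. u n \<in> carrier Z"
    and cau: "\<forall>e>0. \<exists>N. \<forall>m\<ge>N. \<forall>n\<ge>N. vnorm Z (u m \<ominus>\<^bsub>Z\<^esub> u n) < e"
  from u have "\<forall>n. \<exists>w\<in>W. u n = \<phi> w" by (auto simp: transported_simps)
  then obtain s where s: "\<And>n. s n \<in> W" "\<And>n. u n = \<phi> (s n)" by metis
  have "\<forall>e>0. \<exists>N. \<forall>m\<ge>N. \<forall>n\<ge>N. vnorm Y (s m \<ominus>\<^bsub>Y\<^esub> s n) < e"
    using cau s by (simp add: transported_minus transported_simps W_minus)
  then obtain y where y: "y \<in> carrier Y" "(\<lambda>n. vnorm Y (s n \<ominus>\<^bsub>Y\<^esub> y)) \<longlonglongrightarrow> 0"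
    using ban[unfolded is_banach_space_def, THEN conjunct2, rule_format, of s] s(1) Wc by auto
  then have "y \<in> W" using W_closed[of s y] s(1) by simp
  then show "\<exists>x\<in>carrier Z. (\<lambda>n. vnorm Z (u n \<ominus>\<^bsub>Z\<^esub> x)) \<longlonglongrightarrow> 0"
    using y s by (intro bexI[of _ "\<phi> y"]) (simp_all add: transported_minus transported_simps W_minus)
qed

lemma transported_functional:
  assumes f: "f \<in> dual Z"
  shows "\<exists>F\<in>dual Y. (\<forall>x\<in>W. F x = f (\<phi> x)) \<and> dual_norm Y F \<le> dual_norm Z f"
proof (rule hahn_banach[OF ns W, of "\<lambda>x. f (\<phi> x)" "dual_norm Z f"])
  note b = dual_norm_bound[OF transported_normed f]
  show "0 \<le> dual_norm Z f" by (rule b)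
  show "f (\<phi> (x \<oplus>\<^bsub>Y\<^esub> y)) = f (\<phi> x) + f (\<phi> y)" if "x \<in> W" "y \<in> W" for x y
    using that dualD(1)[OF f, of "\<phi> x" "\<phi> y"] by (simp add: transported_simps)
  show "f (\<phi> (c \<odot>\<^bsub>Y\<^esub> x)) = c * f (\<phi> x)" if "x \<in> W" for c x
    using that dualD(2)[OF f, of "\<phi> x" c] by (simp add: transported_simps)
  show "norm (f (\<phi> x)) \<le> dual_norm Z f * vnorm Y x" if "x \<in> W" for x
    using that b(2)[of "\<phi> x"] by (simp add: transported_simps)
  fix F assume F: "F \<in> dual Y" "\<And>x. x \<in> W \<Longrightarrow> F x = f (\<phi> x)"
    "\<And>x. x \<in> carrier Y \<Longrightarrow> norm (F x) \<le> dual_norm Z f * vnorm Y x"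
  have "dual_norm Y F \<le> dual_norm Z f" by (rule dual_norm_le[OF ns b(1) F(3)])
  with F(1,2) show ?thesis by (intro bexI[of _ F]) simp_all
qed

lemma transported_weak_continuous:
  "continuous_map (weak_topology Z) (weak_topology Y) (inv_into W \<phi>)"
  unfolding weak_topology_def[of Y]
proof (rule continuous_on_generated_topo)
  fix V assume "V \<in> {{x \<in> carrier Y. f x \<in> U} | f U. f \<in> dual Y \<and> open U}"
  then obtain f U where V: "V = {x \<in> carrier Y. f x \<in> U}" and f: "f \<in> dual Y" and "open U" by blast
  have "f \<circ> inv_into W \<phi> \<in> dual Z"
  proof (rule dualI)
    fix u assume "u \<in> carrier Z"
    then show "norm ((f \<circ> inv_into W \<phi>) u) \<le> dual_norm Y f * vnorm Z u"
      using dual_norm_bound(2)[OF ns f] inj by (auto simp: transported_simps Wc)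
  qed (use inj W in \<open>auto simp: transported_simps Wc dualD[OF f]\<close>)
  from openin_weak_topology[OF this \<open>open U\<close>]
  have "openin (weak_topology Z) {u \<in> carrier Z. f (inv_into W \<phi> u) \<in> U}" by simp
  moreover have "{u \<in> carrier Z. f (inv_into W \<phi> u) \<in> U} = inv_into W \<phi> -` V \<inter> topspace (weak_topology Z)"
    using inj by (auto simp: V transported_simps Wc)
  ultimately show "openin (weak_topology Z) (inv_into W \<phi> -` V \<inter> topspace (weak_topology Z))" by simp
next
  show "inv_into W \<phi> ` topspace (weak_topology Z) \<subseteq> \<Union> {{x \<in> carrier Y. f x \<in> U} | f U. f \<in> dual Y \<and> open U}"
  proof -
    have "inv_into W \<phi> ` topspace (weak_topology Z) \<subseteq> carrier Y"
      using inj by (auto simp: transported_simps Wc)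
    then show ?thesis
      using topspace_weak_topology[of Y] unfolding weak_topology_def topology_generated_by_topspace
      by simp
  qed
qed

lemma transported_operator:
  assumes T: "bounded_operator X Y T" and TW: "\<And>x. x \<in> carrier X \<Longrightarrow> T x \<in> W"
  shows "bounded_operator X Z (\<lambda>x. \<phi> (T x))"
proof -
  obtain C where C: "\<forall>x\<in>carrier X. vnorm Y (T x) \<le> C * vnorm X x"
    using T by (auto simp: bounded_operator_def)
  have "\<forall>x\<in>carrier X. vnorm Z (\<phi> (T x)) \<le> C * vnorm X x"
    using C TW by (simp add: transported_simps)
  then have "\<exists>C. \<forall>x\<in>carrier X. vnorm Z (\<phi> (T x)) \<le> C * vnorm X x" by (rule exI)
  then show ?thesis
    using T TW unfolding bounded_operator_def by (simp add: Pi_iff transported_simps)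
qed

lemma transported_unconditionally_summable:
  assumes x: "unconditionally_summable q Y x" and xW: "\<And>n. x n \<in> W"
  shows "unconditionally_summable q Z (\<lambda>n. \<phi> (x n))"
  unfolding unconditionally_summable_def
proof
  have wx: "weakly_summable q Y x"
    and lim: "(\<lambda>m. SUP f\<in>dual_ball Y. ereal ((\<Sum>n. norm (f (x (m + n))) powr q) powr (1 / q))) \<longlonglongrightarrow> 0"
    using x by (auto simp: unconditionally_summable_def)
  show "weakly_summable q Z (\<lambda>n. \<phi> (x n))"
    unfolding weakly_summable_def
  proof (intro conjI allI ballI)
    show "\<phi> (x n) \<in> carrier Z" for n using xW by (simp add: transported_simps)
    fix f assume f: "f \<in> dual Z"
    from transported_functional[OF f] obtain F where "F \<in> dual Y" "\<forall>x\<in>W. F x = f (\<phi> x)"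
      by blast
    then show "summable (\<lambda>n. norm (f (\<phi> (x n))) powr q)"
      using wx xW by (auto simp: weakly_summable_def)
  qed
  show "(\<lambda>m. SUP f\<in>dual_ball Z. ereal ((\<Sum>n. norm (f (\<phi> (x (m + n)))) powr q) powr (1 / q))) \<longlonglongrightarrow> 0"
  proof (rule tendsto_sandwich[OF _ _ tendsto_const lim])
    show "\<forall>\<^sub>F m in sequentially.
      0 \<le> (SUP f\<in>dual_ball Z. ereal ((\<Sum>n. norm (f (\<phi> (x (m + n)))) powr q) powr (1 / q)))"
    proof (intro always_eventually allI)
      show "0 \<le> (SUP f\<in>dual_ball Z. ereal ((\<Sum>n. norm (f (\<phi> (x (m + n)))) powr q) powr (1 / q)))" for m
        by (rule SUP_upper2[OF zero_in_dual_ball[OF transported_normed]]) simp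
    qed
    show "\<forall>\<^sub>F m in sequentially.
      (SUP f\<in>dual_ball Z. ereal ((\<Sum>n. norm (f (\<phi> (x (m + n)))) powr q) powr (1 / q)))
      \<le> (SUP f\<in>dual_ball Y. ereal ((\<Sum>n. norm (f (x (m + n))) powr q) powr (1 / q)))"
    proof (intro always_eventually allI SUP_mono)
      fix m f assume "f \<in> dual_ball Z"
      then have f: "f \<in> dual Z" "dual_norm Z f \<le> 1" by (auto simp: dual_ball_def)
      from transported_functional[OF f(1)] obtain F where
        F: "F \<in> dual Y" "\<forall>x\<in>W. F x = f (\<phi> x)" "dual_norm Y F \<le> dual_norm Z f"
        by blast
      then show "\<exists>F\<in>dual_ball Y. ereal ((\<Sum>n. norm (f (\<phi> (x (m + n)))) powr q) powr (1 / q))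
          \<le> ereal ((\<Sum>n. norm (F (x (m + n))) powr q) powr (1 / q))"
        using f xW by (intro bexI[of _ F]) (auto simp: dual_ball_def)
    qed
  qed
qed

lemma transported_weakly_compact:
  assumes T: "bounded_operator X Y T" and TW: "\<And>x. x \<in> carrier X \<Longrightarrow> T x \<in> W"
    and wc: "weakly_compact_operator X Z (\<lambda>x. \<phi> (T x))"
  shows "weakly_compact_operator X Y T"
  unfolding weakly_compact_operator_def
proof
  define B where "B = (\<lambda>x. \<phi> (T x)) ` unit_ball X"
  define K where "K = inv_into W \<phi> ` (weak_topology Z closure_of B)"
  have "compactin (weak_topology Z) (weak_topology Z closure_of B)"
    using wc by (simp add: weakly_compact_operator_def B_def)
  then have K: "compactin (weak_topology Y) K"
    unfolding K_def by (rule image_compactin[OF _ transported_weak_continuous])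
  have Bsub: "B \<subseteq> weak_topology Z closure_of B"
    using TW by (intro closure_of_subset) (auto simp: B_def unit_ball_def transported_simps)
  have "T ` unit_ball X \<subseteq> K"
  proof safe
    fix x assume x: "x \<in> unit_ball X"
    then have "T x = inv_into W \<phi> (\<phi> (T x))" using TW inj by (simp add: unit_ball_def)
    moreover have "\<phi> (T x) \<in> weak_topology Z closure_of B" using Bsub x by (auto simp: B_def)
    ultimately show "T x \<in> K" unfolding K_def by (rule image_eqI)
  qed
  then have "weak_topology Y closure_of (T ` unit_ball X) \<subseteq> K"
    using compactin_imp_closedin[OF Hausdorff_weak_topology[OF ns] K] by (rule closure_of_minimal)
  then show "compactin (weak_topology Y) (weak_topology Y closure_of (T ` unit_ball X))"
    by (rule closed_compactin[OF K _ closedin_closure_of])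
qed (rule T)

end

theorem property_V_all_targets:
  fixes X :: "('k::real_or_complex, 'a) normed_space" and Y :: "('k, 'b) normed_space"
  assumes V: "property_V q X" and X: "is_normed_space X" and Y: "is_banach_space Y"
    and T: "unconditionally_converging q X Y T"
  shows "weakly_compact_operator X Y T"
proof -
  have ns: "is_normed_space Y" using Y by (simp add: is_banach_space_def)
  interpret Y: module "scalar_field :: ('k, 'k) normed_space" Y
    using ns by (simp add: is_normed_space_def)
  have op: "bounded_operator X Y T" using T by (simp add: unconditionally_converging_def)
  have Tc: "T x \<in> carrier Y" if "x \<in> carrier X" for x
    using op that by (auto simp: bounded_operator_def)
  have T_add: "T (x \<oplus>\<^bsub>X\<^esub> y) = T x \<oplus>\<^bsub>Y\<^esub> T y" if "x \<in> carrier X" "y \<in> carrier X" for x y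
    using op that by (auto simp: bounded_operator_def)
  have T_scale: "T (c \<odot>\<^bsub>X\<^esub> x) = c \<odot>\<^bsub>Y\<^esub> T x" if "x \<in> carrier X" for c x
    using op that by (auto simp: bounded_operator_def)
  define appr where "appr s y \<longleftrightarrow>
    (\<forall>n. s n \<in> carrier X) \<and> (\<lambda>n. vnorm Y (T (s n) \<ominus>\<^bsub>Y\<^esub> y)) \<longlonglongrightarrow> 0" for s y
  define W where "W = {y \<in> carrier Y. \<exists>s. appr s y}"
  define \<phi> where "\<phi> = (\<lambda>y. SOME s. appr s y)"
  have appr_\<phi>: "appr (\<phi> y) y" if "y \<in> W" for y
    unfolding \<phi>_def by (rule someI_ex[of "\<lambda>s. appr s y"]) (use that in \<open>auto simp: W_def\<close>)
  have appr_unique: "y = z" if "appr s y" "appr s z" "y \<in> carrier Y" "z \<in> carrier Y" for s y z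
  proof -
    have "(\<lambda>n. vnorm Y (T (s n) \<ominus>\<^bsub>Y\<^esub> y) + vnorm Y (T (s n) \<ominus>\<^bsub>Y\<^esub> z)) \<longlonglongrightarrow> 0 + 0"
      using that by (intro tendsto_add) (auto simp: appr_def)
    moreover have "vnorm Y (y \<ominus>\<^bsub>Y\<^esub> z) \<le> vnorm Y (T (s n) \<ominus>\<^bsub>Y\<^esub> y) + vnorm Y (T (s n) \<ominus>\<^bsub>Y\<^esub> z)" for n
      using ns_norm_minus_triangle[OF ns, of y "T (s n)" z]
        ns_norm_minus_commute[OF ns, of y "T (s n)"] that Tc by (simp add: appr_def)
    ultimately have "vnorm Y (y \<ominus>\<^bsub>Y\<^esub> z) \<le> 0 + 0"
      by (intro tendsto_lowerbound[of _ _ sequentially]) auto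
    then show ?thesis
      using ns_norm_ge[OF ns ns_minus[OF ns that(3,4)]] ns_eq_iff[OF ns that(3,4)] by simp
  qed
  have inj: "inj_on \<phi> W"
  proof (rule inj_onI)
    fix y z assume yz: "y \<in> W" "z \<in> W" "\<phi> y = \<phi> z"
    then show "y = z"
      using appr_unique[of "\<phi> y" y z] appr_\<phi>[OF yz(1)] appr_\<phi>[OF yz(2)] by (simp add: W_def)
  qed
  have Wc: "W \<subseteq> carrier Y" by (auto simp: W_def)
  have TW: "T x \<in> W" if "x \<in> carrier X" for x
  proof -
    have "vnorm Y (T x \<ominus>\<^bsub>Y\<^esub> T x) = 0" using ns_eq_iff[OF ns] Tc[OF that] by blast
    then have "appr (\<lambda>n. x) (T x)" using that by (simp add: appr_def)
    then show ?thesis using Tc[OF that] by (auto simp: W_def)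
  qed
  have W_zero: "\<zero>\<^bsub>Y\<^esub> \<in> W"
  proof -
    have "T (0 \<odot>\<^bsub>X\<^esub> \<zero>\<^bsub>X\<^esub>) = \<zero>\<^bsub>Y\<^esub>"
      by (simp add: T_scale ns_zero[OF X] ns_scale_0[OF ns] Tc)
    then show ?thesis using TW[of "0 \<odot>\<^bsub>X\<^esub> \<zero>\<^bsub>X\<^esub>"] by (simp add: ns_zero[OF X] ns_scale[OF X])
  qed
  have W_add: "y \<oplus>\<^bsub>Y\<^esub> z \<in> W" if "y \<in> W" "z \<in> W" for y z
  proof -
    have c: "y \<in> carrier Y" "z \<in> carrier Y" using that Wc by auto
    have s: "\<phi> y n \<in> carrier X" "\<phi> z n \<in> carrier X" for n
      using appr_\<phi>[OF that(1)] appr_\<phi>[OF that(2)] by (auto simp: appr_def)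
    have "(\<lambda>n. vnorm Y (T (\<phi> y n) \<ominus>\<^bsub>Y\<^esub> y) + vnorm Y (T (\<phi> z n) \<ominus>\<^bsub>Y\<^esub> z)) \<longlonglongrightarrow> 0 + 0"
      using appr_\<phi>[OF that(1)] appr_\<phi>[OF that(2)] by (intro tendsto_add) (auto simp: appr_def)
    then have lim: "(\<lambda>n. vnorm Y (T (\<phi> y n) \<ominus>\<^bsub>Y\<^esub> y) + vnorm Y (T (\<phi> z n) \<ominus>\<^bsub>Y\<^esub> z)) \<longlonglongrightarrow> 0"
      by simp
    have eq: "T (\<phi> y n \<oplus>\<^bsub>X\<^esub> \<phi> z n) \<ominus>\<^bsub>Y\<^esub> (y \<oplus>\<^bsub>Y\<^esub> z) = (T (\<phi> y n) \<ominus>\<^bsub>Y\<^esub> y) \<oplus>\<^bsub>Y\<^esub> (T (\<phi> z n) \<ominus>\<^bsub>Y\<^esub> z)" for n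
      using c s[of n] Tc[OF s(1)[of n]] Tc[OF s(2)[of n]]
      by (simp add: T_add ns_minus_eq[OF ns] ns_scale_add[OF ns] ns_scale[OF ns] ns_add[OF ns] Y.M.a_ac)
    have "(\<lambda>n. vnorm Y (T (\<phi> y n \<oplus>\<^bsub>X\<^esub> \<phi> z n) \<ominus>\<^bsub>Y\<^esub> (y \<oplus>\<^bsub>Y\<^esub> z))) \<longlonglongrightarrow> 0"
    proof (rule tendsto_sandwich[OF _ _ tendsto_const lim])
      show "\<forall>\<^sub>F n in sequentially. 0 \<le> vnorm Y (T (\<phi> y n \<oplus>\<^bsub>X\<^esub> \<phi> z n) \<ominus>\<^bsub>Y\<^esub> (y \<oplus>\<^bsub>Y\<^esub> z))"
        using c s by (intro always_eventually allI ns_norm_ge[OF ns])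
          (simp add: ns_minus[OF ns] ns_add[OF ns] ns_add[OF X] Tc)
      show "\<forall>\<^sub>F n in sequentially. vnorm Y (T (\<phi> y n \<oplus>\<^bsub>X\<^esub> \<phi> z n) \<ominus>\<^bsub>Y\<^esub> (y \<oplus>\<^bsub>Y\<^esub> z))
          \<le> vnorm Y (T (\<phi> y n) \<ominus>\<^bsub>Y\<^esub> y) + vnorm Y (T (\<phi> z n) \<ominus>\<^bsub>Y\<^esub> z)"
        unfolding eq using c s
        by (intro always_eventually allI ns_norm_triangle[OF ns]) (simp_all add: ns_minus[OF ns] Tc)
    qed
    then have "appr (\<lambda>n. \<phi> y n \<oplus>\<^bsub>X\<^esub> \<phi> z n) (y \<oplus>\<^bsub>Y\<^esub> z)"
      using s by (simp add: appr_def ns_add[OF X])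
    then show ?thesis using c by (auto simp: W_def ns_add[OF ns])
  qed
  have W_scale: "a \<odot>\<^bsub>Y\<^esub> y \<in> W" if "y \<in> W" for a y
  proof -
    have c: "y \<in> carrier Y" using that Wc by auto
    have s: "\<phi> y n \<in> carrier X" for n using appr_\<phi>[OF that] by (auto simp: appr_def)
    have eq: "T (a \<odot>\<^bsub>X\<^esub> \<phi> y n) \<ominus>\<^bsub>Y\<^esub> a \<odot>\<^bsub>Y\<^esub> y = a \<odot>\<^bsub>Y\<^esub> (T (\<phi> y n) \<ominus>\<^bsub>Y\<^esub> y)" for n
      using c s[of n] Tc[OF s[of n]]
      by (simp add: T_scale ns_minus_eq[OF ns] ns_scale_add[OF ns] ns_scale[OF ns] ns_scale_scale[OF ns])
    have "(\<lambda>n. norm a * vnorm Y (T (\<phi> y n) \<ominus>\<^bsub>Y\<^esub> y)) \<longlonglongrightarrow> norm a * 0"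
      using appr_\<phi>[OF that] by (intro tendsto_mult_left) (auto simp: appr_def)
    then have "appr (\<lambda>n. a \<odot>\<^bsub>X\<^esub> \<phi> y n) (a \<odot>\<^bsub>Y\<^esub> y)"
      using s c by (simp add: appr_def ns_scale[OF X] eq ns_norm_scale[OF ns] ns_minus[OF ns] Tc)
    then show ?thesis using c by (auto simp: W_def ns_scale[OF ns])
  qed
  have W_closed: "y \<in> W"
    if s: "\<And>n. s n \<in> W" and y: "y \<in> carrier Y" and lim: "(\<lambda>n. vnorm Y (s n \<ominus>\<^bsub>Y\<^esub> y)) \<longlonglongrightarrow> 0" for s y
  proof -
    have "\<exists>x\<in>carrier X. vnorm Y (T x \<ominus>\<^bsub>Y\<^esub> s n) < 1 / real (Suc n)" for n
    proof -
      have a: "appr (\<phi> (s n)) (s n)" using appr_\<phi> s by blast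
      then have "\<forall>\<^sub>F k in sequentially. vnorm Y (T (\<phi> (s n) k) \<ominus>\<^bsub>Y\<^esub> s n) < 1 / real (Suc n)"
        by (intro order_tendstoD(2)[where y = 0]) (auto simp: appr_def)
      then obtain k where "vnorm Y (T (\<phi> (s n) k) \<ominus>\<^bsub>Y\<^esub> s n) < 1 / real (Suc n)"
        by (auto simp: eventually_sequentially)
      then show ?thesis using a by (auto simp: appr_def)
    qed
    then obtain x where x: "\<And>n. x n \<in> carrier X" "\<And>n. vnorm Y (T (x n) \<ominus>\<^bsub>Y\<^esub> s n) < 1 / real (Suc n)"
      by metis
    have "(\<lambda>n. 1 / real (Suc n) + vnorm Y (s n \<ominus>\<^bsub>Y\<^esub> y)) \<longlonglongrightarrow> 0 + 0"
      using lim by (intro tendsto_add LIMSEQ_Suc lim_1_over_n)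
    then have lim': "(\<lambda>n. 1 / real (Suc n) + vnorm Y (s n \<ominus>\<^bsub>Y\<^esub> y)) \<longlonglongrightarrow> 0" by simp
    have "(\<lambda>n. vnorm Y (T (x n) \<ominus>\<^bsub>Y\<^esub> y)) \<longlonglongrightarrow> 0"
    proof (rule tendsto_sandwich[OF _ _ tendsto_const lim'])
      show "\<forall>\<^sub>F n in sequentially. 0 \<le> vnorm Y (T (x n) \<ominus>\<^bsub>Y\<^esub> y)"
        using x y by (intro always_eventually allI ns_norm_ge[OF ns]) (simp add: ns_minus[OF ns] Tc)
      have "vnorm Y (T (x n) \<ominus>\<^bsub>Y\<^esub> y) \<le> 1 / real (Suc n) + vnorm Y (s n \<ominus>\<^bsub>Y\<^esub> y)" for n
        using ns_norm_minus_triangle[OF ns Tc[OF x(1)[of n]] subsetD[OF Wc s[of n]] y] x(2)[of n]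
        by linarith
      then show "\<forall>\<^sub>F n in sequentially.
          vnorm Y (T (x n) \<ominus>\<^bsub>Y\<^esub> y) \<le> 1 / real (Suc n) + vnorm Y (s n \<ominus>\<^bsub>Y\<^esub> y)"
        by (intro always_eventually allI)
    qed
    then have "appr x y" using x by (simp add: appr_def)
    then show ?thesis using y by (auto simp: W_def)
  qed
  have "closed_subspace Y W"
    unfolding closed_subspace_def
  proof (intro conjI allI ballI impI)
    show "y \<in> W" if "\<forall>n. s n \<in> W" "y \<in> carrier Y" "(\<lambda>n. vnorm Y (s n \<ominus>\<^bsub>Y\<^esub> y)) \<longlonglongrightarrow> 0" for s y
      using that(1) by (intro W_closed[OF _ that(2,3)]) simp
  qed (use Wc W_zero W_add W_scale in simp_all)
  note tr = Y this inj
  have "unconditionally_converging q X (transported Y W \<phi>) (\<lambda>x. \<phi> (T x))"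
    unfolding unconditionally_converging_def
  proof (intro conjI allI impI)
    show "bounded_operator X (transported Y W \<phi>) (\<lambda>x. \<phi> (T x))"
      by (rule transported_operator[OF tr op TW])
    fix x assume x: "weakly_summable q X x"
    then have "unconditionally_summable q Y (\<lambda>n. T (x n))"
      using T by (simp add: unconditionally_converging_def)
    then show "unconditionally_summable q (transported Y W \<phi>) (\<lambda>n. \<phi> (T (x n)))"
      by (rule transported_unconditionally_summable[OF tr])
        (use x TW in \<open>auto simp: weakly_summable_def\<close>)
  qed
  with transported_banach[OF tr]
  have "weakly_compact_operator X (transported Y W \<phi>) (\<lambda>x. \<phi> (T x))"
    using V by (simp add: property_V_def)
  then show ?thesis by (rule transported_weakly_compact[OF tr op, rotated]) (rule TW)
qed

end

theory Submission
  imports Defs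
begin

text \<open>
  That \<open>q\<close>-\<open>(V)\<close> passes from the sum \<open>L\<close> to a coordinate space \<open>X n\<close> holds because \<open>X n\<close> is a
  complemented subspace of \<open>L\<close>: an unconditionally \<open>q\<close>-converging \<open>T\<close> on \<open>X n\<close> composed with the
  coordinate projection is unconditionally \<open>q\<close>-converging on \<open>L\<close>, hence weakly compact, and the
  unit ball of \<open>X n\<close> is contained in the projection of the unit ball of \<open>L\<close>.

  For the converse, unconditional \<open>q\<close>-convergence enters only through the fact that it is inherited
  by the compositions of \<open>T\<close> with the coordinate embeddings, so that these are weakly compact. The
  substance is then a statement without \<open>q\<close>: for \<open>1 < p < \<infinity>\<close> an operator \<open>T\<close> on \<open>L\<close> is weakly
  compact as soon as all its restrictions \<open>T\<^sub>n\<close> to the coordinate spaces are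
  (\<open>weakly_compact_on_lp_sum\<close>). The classical argument is that \<open>L\<^sup>*\<^sup>*\<close> is the \<open>\<ell>\<^sub>p\<close>-sum of the
  \<open>(X n)\<^sup>*\<^sup>*\<close>, in which the finitely supported elements are dense; \<open>T\<^sup>*\<^sup>*\<close> maps these into \<open>Y\<close>,
  which is closed in \<open>Y\<^sup>*\<^sup>*\<close>, so that \<open>T\<^sup>*\<^sup>*\<close> maps \<open>L\<^sup>*\<^sup>*\<close> into \<open>Y\<close>.

  The proof below carries this out inside \<open>Y\<close>, without biduals. Let \<open>K n\<close> be the weak closure of
  the image of the unit ball of \<open>X n\<close> under \<open>T\<^sub>n\<close>. By Tychonoff's theorem the product of the
  \<open>K n\<close> is compact. The sequences \<open>(T\<^sub>n x\<^sub>n)\<^sub>n\<close> for \<open>x\<close> in the unit ball of \<open>L\<close> lie in it, and so do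
  their limits, all of which belong to a closed set, \<open>polar_hull\<close>, of sequences that satisfy every
  bound on \<open>\<bar>g\<^sub>0(y\<^sub>0) + \<dots> + g\<^sub>m(y\<^sub>m)\<bar>\<close> valid on the sequences \<open>(T\<^sub>n x\<^sub>n)\<^sub>n\<close>. Two facts make
  summation a weakly continuous map from this set to \<open>Y\<close>. First, the series \<open>\<Sum>y\<^sub>n\<close> of such a
  sequence converges in norm. Otherwise there would be, for every \<open>K\<close>, disjoint blocks of indices
  \<open>B\<^sub>1, \<dots>, B\<^sub>K\<close> over which it sums to vectors of norm at least some \<open>d > 0\<close>. Norming functionals of
  these vectors, composed with \<open>T\<close> and restricted to the blocks, add up to a functional on \<open>L\<close> whose
  norm would have to be at least \<open>K * d\<close>, whereas functionals on disjoint blocks with norms at most \<open>C\<close>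
  add up to one of norm at most \<open>C * K\<^bsup>1 - 1/p\<^esup>\<close>. Second, the convergence is uniform after
  applying a fixed functional of \<open>Y\<close>, because functionals on \<open>L\<close> have small tails; this is where
  \<open>p > 1\<close> is needed. The image of the compact set under summation is therefore weakly compact, and it
  contains the image of the unit ball of \<open>L\<close>.
\<close>

section \<open>Inequalities for powers\<close>

lemma powr_convex_combination:
  fixes a b s t p :: real
  assumes "0 \<le> a" "0 \<le> b" "0 \<le> s" "0 \<le> t" "s + t = 1" "1 \<le> p"
  shows "(s * a + t * b) powr p \<le> s * a powr p + t * b powr p"
proof -
  have shrink: "(u * c) powr p \<le> u * c powr p" if "0 \<le> u" "u \<le> 1" "0 \<le> c" for u c :: real
  proof -
    have "u powr p \<le> u"
      using that assms powr_mono'[of 1 p u] by (cases "u = 0") auto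
    then show ?thesis by (simp add: powr_mult mult_right_mono)
  qed
  consider "a = 0" | "b = 0" | "a > 0" "b > 0" using assms by linarith
  then show ?thesis
  proof cases
    case 1
    then show ?thesis using shrink[of t b] assms by simp
  next
    case 2
    then show ?thesis using shrink[of s a] assms by simp
  next
    case 3
    have "\<forall>x\<in>{0<..}. \<forall>y\<in>{0<..}. \<forall>u\<ge>0. \<forall>v\<ge>0. u + v = 1 \<longrightarrow>
        (u *\<^sub>R x + v *\<^sub>R y) powr p \<le> u * x powr p + v * y powr p"
      using powr_convex[OF \<open>1 \<le> p\<close>] unfolding convex_on_def by (rule conjunct2)
    from this[rule_format, of a b s t] show ?thesis using 3 assms by simp
  qed
qed

text \<open>
  If the \<open>p\<close>-norms of \<open>a\<close> and \<open>b\<close> are at most \<open>A\<close> and \<open>B\<close>, then \<open>(a + b) / (A + B)\<close> is a convex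
  combination of \<open>a / A\<close> and \<open>b / B\<close>, to which convexity of the \<open>p\<close>-th power applies termwise.
\<close>

lemma minkowski_powr:
  fixes a b :: "nat \<Rightarrow> real"
  assumes a: "\<And>n. 0 \<le> a n" "summable (\<lambda>n. a n powr p)"
    and b: "\<And>n. 0 \<le> b n" "summable (\<lambda>n. b n powr p)"
    and p: "1 \<le> p"
  shows "summable (\<lambda>n. (a n + b n) powr p)"
    and "(\<Sum>n. (a n + b n) powr p) powr (1 / p)
      \<le> (\<Sum>n. a n powr p) powr (1 / p) + (\<Sum>n. b n powr p) powr (1 / p)"
proof -
  have main: "summable (\<lambda>n. (a n + b n) powr p) \<and> (\<Sum>n. (a n + b n) powr p) \<le> (A + B) powr p"
    if A: "0 < A" "(\<Sum>n. a n powr p) \<le> A powr p" and B: "0 < B" "(\<Sum>n. b n powr p) \<le> B powr p"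
    for A B
  proof -
    define s where "s = A / (A + B)"
    define t where "t = B / (A + B)"
    have st: "0 \<le> s" "0 \<le> t" "s + t = 1" using A B by (auto simp: s_def t_def add_divide_distrib[symmetric])
    define bnd where "bnd = (\<lambda>n. (A + B) powr p * (s * (a n powr p / A powr p) + t * (b n powr p / B powr p)))"
    have le: "(a n + b n) powr p \<le> bnd n" for n
    proof -
      have "a n + b n = (A + B) * (s * (a n / A) + t * (b n / B))"
        using A B by (simp add: s_def t_def distrib_left)
      then have "(a n + b n) powr p = (A + B) powr p * (s * (a n / A) + t * (b n / B)) powr p"
        by (simp add: powr_mult)
      also have "\<dots> \<le> (A + B) powr p * (s * (a n / A) powr p + t * (b n / B) powr p)"
        using a(1)[of n] b(1)[of n] A B st p by (intro mult_left_mono powr_convex_combination) auto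
      finally show ?thesis using A B a(1)[of n] b(1)[of n] by (simp add: bnd_def powr_divide)
    qed
    have "(\<lambda>n. s * (a n powr p / A powr p) + t * (b n powr p / B powr p)) sums
        (s * ((\<Sum>n. a n powr p) / A powr p) + t * ((\<Sum>n. b n powr p) / B powr p))"
      using a(2) b(2) by (intro sums_add sums_mult sums_divide summable_sums)
    then have sums: "bnd sums ((A + B) powr p *
        (s * ((\<Sum>n. a n powr p) / A powr p) + t * ((\<Sum>n. b n powr p) / B powr p)))"
      unfolding bnd_def by (rule sums_mult)
    have "s * ((\<Sum>n. a n powr p) / A powr p) + t * ((\<Sum>n. b n powr p) / B powr p) \<le> s * 1 + t * 1"
      using A B st by (intro add_mono mult_left_mono) (auto simp: divide_le_eq)
    then have sumle: "suminf bnd \<le> (A + B) powr p"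
      unfolding sums_unique[OF sums, symmetric] using st(3) by (intro mult_left_le) simp_all
    have "summable (\<lambda>n. (a n + b n) powr p)"
      using le by (intro summable_comparison_test'[OF sums_summable[OF sums], of 0]) simp
    moreover from this have "(\<Sum>n. (a n + b n) powr p) \<le> suminf bnd"
      using le sums by (intro suminf_le) (auto simp: sums_iff)
    ultimately show ?thesis using sumle by simp
  qed
  define A where "A = (\<Sum>n. a n powr p) powr (1 / p)"
  define B where "B = (\<Sum>n. b n powr p) powr (1 / p)"
  have nn: "0 \<le> (\<Sum>n. a n powr p)" "0 \<le> (\<Sum>n. b n powr p)"
    using a b by (auto intro!: suminf_nonneg)
  have AB: "A powr p = (\<Sum>n. a n powr p)" "B powr p = (\<Sum>n. b n powr p)"
    using nn p by (simp_all add: A_def B_def powr_powr)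
  have AB0: "0 \<le> A" "0 \<le> B" by (simp_all add: A_def B_def)
  \<comment> \<open>Enlarging both bounds by \<open>e\<close> makes them positive, so that one may divide by them.\<close>
  have eps: "summable (\<lambda>n. (a n + b n) powr p) \<and>
      (\<Sum>n. (a n + b n) powr p) \<le> ((A + e) + (B + e)) powr p" if "0 < e" for e
    using that AB0 p by (intro main) (auto simp: AB[symmetric] intro!: powr_mono2)
  show summ: "summable (\<lambda>n. (a n + b n) powr p)" using eps[of 1] by simp
  have "(\<Sum>n. (a n + b n) powr p) powr (1 / p) \<le> (A + B) + e" if "0 < e" for e
  proof -
    have "(\<Sum>n. (a n + b n) powr p) powr (1 / p) \<le> (((A + e / 2) + (B + e / 2)) powr p) powr (1 / p)"
      using eps[of "e / 2"] that p summ by (intro powr_mono2) (auto intro!: suminf_nonneg)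
    also have "\<dots> = (A + B) + e" using that AB0 p by (simp add: powr_powr)
    finally show ?thesis .
  qed
  then show "(\<Sum>n. (a n + b n) powr p) powr (1 / p)
      \<le> (\<Sum>n. a n powr p) powr (1 / p) + (\<Sum>n. b n powr p) powr (1 / p)"
    unfolding A_def[symmetric] B_def[symmetric] by (rule field_le_epsilon)
qed

text \<open>
  A linearized form of the power mean inequality. Summed over \<open>K\<close> terms with \<open>\<Sum>a\<^bsup>p\<^esup> \<le> 1\<close> it bounds
  \<open>\<Sum>a\<close> by \<open>K * e\<close> plus a constant, where \<open>e\<close> is at one's disposal; this is all that is needed
  from the sharp bound \<open>K\<^bsup>1 - 1/p\<^esup>\<close>, and it can be added up block by block.
\<close>

lemma le_linear_plus_powr:
  fixes a e p :: real
  assumes "0 \<le> a" "0 < e" "1 \<le> p"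
  shows "a \<le> e + e powr (1 - p) * a powr p"
proof (cases "a \<le> e")
  case False
  then have a: "0 < e" "e < a" using assms by auto
  have "a powr (1 - p) \<le> e powr (1 - p)"
    using a assms by (intro powr_mono2') auto
  then have "a powr (1 - p) * a powr p \<le> e powr (1 - p) * a powr p" by (rule mult_right_mono) simp
  moreover have "a powr (1 - p) * a powr p = a" using a by (simp add: powr_add[symmetric])
  ultimately show ?thesis using a by simp
qed (use assms in \<open>simp add: add_increasing2\<close>)

section \<open>Normed spaces and operators\<close>

text \<open>
  Hahn--Banach for the functional \<open>a w \<mapsto> a \<parallel>w\<parallel>\<close> on the line through \<open>w\<close>. That its value at \<open>w\<close> is a
  nonnegative real makes contributions of several such functionals add up without cancellation.
\<close>

lemma norming_functional:
  fixes Y :: "('k::real_or_complex, 'a) normed_space"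
  assumes ns: "is_normed_space Y" and w: "w \<in> carrier Y"
  obtains G where "G \<in> dual Y" "\<And>y. y \<in> carrier Y \<Longrightarrow> norm (G y) \<le> vnorm Y y"
    "G w = of_real (vnorm Y w)"
proof (cases "vnorm Y w = 0")
  case True
  show ?thesis
    by (rule that[of "\<lambda>_. 0"]) (use True ns_norm_ge[OF ns] in \<open>auto intro!: dualI[of _ _ 0]\<close>)
next
  case w0: False
  define Z where "Z = range (\<lambda>a. a \<odot>\<^bsub>Y\<^esub> w)"
  have inj: "a = b" if "a \<odot>\<^bsub>Y\<^esub> w = b \<odot>\<^bsub>Y\<^esub> w" for a b
  proof -
    have "a \<odot>\<^bsub>Y\<^esub> w \<ominus>\<^bsub>Y\<^esub> b \<odot>\<^bsub>Y\<^esub> w = (a + - 1 * b) \<odot>\<^bsub>Y\<^esub> w"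
      using w by (simp only: ns_minus_eq[OF ns] ns_scale[OF ns] ns_scale_scale[OF ns] ns_add_scale[OF ns])
    then have "vnorm Y ((a + - 1 * b) \<odot>\<^bsub>Y\<^esub> w) = 0"
      using that ns_eq_iff[OF ns ns_scale[OF ns w] ns_scale[OF ns w], of a b] by simp
    then show ?thesis using w0 by (simp add: ns_norm_scale[OF ns w])
  qed
  define f where "f = (\<lambda>z. (THE a. z = a \<odot>\<^bsub>Y\<^esub> w) * of_real (vnorm Y w))"
  have f: "f (a \<odot>\<^bsub>Y\<^esub> w) = a * of_real (vnorm Y w)" for a
    unfolding f_def using inj by (intro arg_cong2[where f = "(*)"] the_equality) auto
  have pos: "0 \<le> vnorm Y w" by (rule ns_norm_ge[OF ns w])
  obtain F where F: "F \<in> dual Y" "\<And>z. z \<in> Z \<Longrightarrow> F z = f z"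
    "\<And>x. x \<in> carrier Y \<Longrightarrow> norm (F x) \<le> 1 * vnorm Y x"
  proof (rule hahn_banach[OF ns, of Z f 1])
    show "Z \<subseteq> carrier Y" using w by (auto simp: Z_def ns_scale[OF ns])
    show "\<zero>\<^bsub>Y\<^esub> \<in> Z" unfolding Z_def using ns_scale_0[OF ns w] by (metis rangeI)
    show "x \<oplus>\<^bsub>Y\<^esub> y \<in> Z" "f (x \<oplus>\<^bsub>Y\<^esub> y) = f x + f y" if "x \<in> Z" "y \<in> Z" for x y
      using that w by (auto simp: Z_def f ns_add_scale[OF ns, symmetric] distrib_right)
    show "c \<odot>\<^bsub>Y\<^esub> x \<in> Z" "f (c \<odot>\<^bsub>Y\<^esub> x) = c * f x" if "x \<in> Z" for c x
      using that w by (auto simp: Z_def f ns_scale_scale[OF ns])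
    show "norm (f x) \<le> 1 * vnorm Y x" if "x \<in> Z" for x
      using that w pos by (auto simp: Z_def f ns_norm_scale[OF ns] norm_mult)
  qed auto
  have "F (1 \<odot>\<^bsub>Y\<^esub> w) = of_real (vnorm Y w)" using F(2)[of "1 \<odot>\<^bsub>Y\<^esub> w"] by (simp add: Z_def f)
  then show ?thesis using that[OF F(1)] F(3) w by (simp add: ns_one[OF ns])
qed

lemma ns_zero_add:
  fixes Y :: "('k::real_or_complex, 'a) normed_space"
  assumes "is_normed_space Y" "x \<in> carrier Y"
  shows "\<zero>\<^bsub>Y\<^esub> \<oplus>\<^bsub>Y\<^esub> x = x" and "x \<oplus>\<^bsub>Y\<^esub> \<zero>\<^bsub>Y\<^esub> = x"
proof -
  interpret module "scalar_field :: ('k, 'k) normed_space" Y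
    using assms by (simp add: is_normed_space_def)
  show "\<zero>\<^bsub>Y\<^esub> \<oplus>\<^bsub>Y\<^esub> x = x" "x \<oplus>\<^bsub>Y\<^esub> \<zero>\<^bsub>Y\<^esub> = x" using assms by simp_all
qed

lemma bounded_operator_bound:
  assumes T: "bounded_operator X Y T" and X: "is_normed_space X"
  obtains C where "0 < C" "\<And>x. x \<in> carrier X \<Longrightarrow> vnorm Y (T x) \<le> C * vnorm X x"
proof -
  obtain C where C: "\<forall>x\<in>carrier X. vnorm Y (T x) \<le> C * vnorm X x"
    using T unfolding bounded_operator_def by blast
  have "vnorm Y (T x) \<le> (\<bar>C\<bar> + 1) * vnorm X x" if x: "x \<in> carrier X" for x
    using C[rule_format, OF x] mult_right_mono[OF _ ns_norm_ge[OF X x], of C "\<bar>C\<bar> + 1"] by linarith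
  then show ?thesis by (intro that[of "\<bar>C\<bar> + 1"]) auto
qed

lemma dual_compose:
  assumes T: "bounded_operator X Y T" and f: "f \<in> dual Y"
    and X: "is_normed_space X" and Y: "is_normed_space Y"
  shows "(\<lambda>x. f (T x)) \<in> dual X"
proof -
  obtain C where C: "\<And>x. x \<in> carrier X \<Longrightarrow> vnorm Y (T x) \<le> C * vnorm X x"
    using bounded_operator_bound[OF T X] by blast
  have Tc: "T x \<in> carrier Y" if "x \<in> carrier X" for x
    using T that by (auto simp: bounded_operator_def)
  show ?thesis
  proof (rule dualI)
    fix x assume x: "x \<in> carrier X"
    have "norm (f (T x)) \<le> dual_norm Y f * vnorm Y (T x)"
      by (rule dual_norm_bound(2)[OF Y f Tc[OF x]])
    also have "\<dots> \<le> dual_norm Y f * (C * vnorm X x)"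
      by (intro mult_left_mono C x dual_norm_bound(1)[OF Y f])
    finally show "norm (f (T x)) \<le> dual_norm Y f * C * vnorm X x" by (simp add: mult.assoc)
  qed (use T Tc in \<open>auto simp: bounded_operator_def dualD[OF f]\<close>)
qed


lemma bounded_operator_compose:
  assumes S: "bounded_operator X Y S" and T: "bounded_operator Y Z T"
    and X: "is_normed_space X" and Y: "is_normed_space Y"
  shows "bounded_operator X Z (\<lambda>x. T (S x))"
proof -
  have Sc: "S x \<in> carrier Y" if "x \<in> carrier X" for x
    using S that by (auto simp: bounded_operator_def)
  obtain C where C: "\<And>x. x \<in> carrier X \<Longrightarrow> vnorm Y (S x) \<le> C * vnorm X x"
    using bounded_operator_bound[OF S X] by blast
  obtain D where D: "0 < D" "\<And>x. x \<in> carrier Y \<Longrightarrow> vnorm Z (T x) \<le> D * vnorm Y x"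
    using bounded_operator_bound[OF T Y] by blast
  have "vnorm Z (T (S x)) \<le> (D * C) * vnorm X x" if x: "x \<in> carrier X" for x
    using order_trans[OF D(2)[OF Sc[OF x]] mult_left_mono[OF C[OF x], of D]] D(1)
    by (simp add: mult.assoc)
  then have "\<exists>E. \<forall>x\<in>carrier X. vnorm Z (T (S x)) \<le> E * vnorm X x" by blast
  then show ?thesis
    using S T unfolding bounded_operator_def by (auto simp: Pi_iff)
qed

lemma unconditionally_converging_compose:
  assumes S: "bounded_operator X Y S" and T: "unconditionally_converging q Y Z T"
    and X: "is_normed_space X" and Y: "is_normed_space Y"
  shows "unconditionally_converging q X Z (\<lambda>x. T (S x))"
  unfolding unconditionally_converging_def
proof (intro conjI allI impI)
  show "bounded_operator X Z (\<lambda>x. T (S x))"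
    using T by (intro bounded_operator_compose[OF S _ X Y]) (simp add: unconditionally_converging_def)
  fix x assume x: "weakly_summable q X x"
  have "S (x n) \<in> carrier Y" for n
    using S x by (auto simp: bounded_operator_def weakly_summable_def)
  then have "weakly_summable q Y (\<lambda>n. S (x n))"
    using dual_compose[OF S _ X Y] x by (auto simp: weakly_summable_def)
  then show "unconditionally_summable q Z (\<lambda>n. T (S (x n)))"
    using T by (simp add: unconditionally_converging_def)
qed

text \<open>The weak topology is Hausdorff, so a weakly compact set is weakly closed and contains the
  closure of each of its subsets.\<close>

lemma weakly_compact_operatorI:
  assumes Y: "is_normed_space Y" and T: "bounded_operator X Y T"
    and K: "compactin (weak_topology Y) K" and sub: "(T ` unit_ball X) \<subseteq> K"
  shows "weakly_compact_operator X Y T"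
  unfolding weakly_compact_operator_def
proof
  have "weak_topology Y closure_of (T ` unit_ball X) \<subseteq> K"
    using sub compactin_imp_closedin[OF Hausdorff_weak_topology[OF Y] K] by (rule closure_of_minimal)
  then show "compactin (weak_topology Y) (weak_topology Y closure_of (T ` unit_ball X))"
    by (rule closed_compactin[OF K _ closedin_closure_of])
qed (rule T)

text \<open>The weak topology is initial with respect to the dual.\<close>

lemma continuous_map_weak_topologyI:
  assumes f: "\<And>x. x \<in> topspace Q \<Longrightarrow> f x \<in> carrier Y"
    and cont: "\<And>g. g \<in> dual Y \<Longrightarrow> continuous_map Q euclidean (\<lambda>x. g (f x))"
  shows "continuous_map Q (weak_topology Y) f"
  unfolding weak_topology_def
proof (rule continuous_on_generated_topo)
  fix V assume "V \<in> {{x \<in> carrier Y. g x \<in> U} | g U. g \<in> dual Y \<and> open U}"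
  then obtain g U where V: "V = {x \<in> carrier Y. g x \<in> U}" and g: "g \<in> dual Y" and U: "open U" by blast
  have "openin Q {x \<in> topspace Q. g (f x) \<in> U}"
    using U by (intro openin_continuous_map_preimage[OF cont[OF g]]) auto
  moreover have "{x \<in> topspace Q. g (f x) \<in> U} = f -` V \<inter> topspace Q"
    unfolding V using f by auto
  ultimately show "openin Q (f -` V \<inter> topspace Q)" by simp
next
  show "f ` topspace Q \<subseteq> \<Union> {{x \<in> carrier Y. g x \<in> U} | g U. g \<in> dual Y \<and> open U}"
    using f topspace_weak_topology[of Y]
    unfolding weak_topology_def topology_generated_by_topspace by blast
qed

primrec partial_sum :: "('k, 'a) normed_space \<Rightarrow> (nat \<Rightarrow> 'a) \<Rightarrow> nat \<Rightarrow> 'a" where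
  "partial_sum Y y 0 = \<zero>\<^bsub>Y\<^esub>"
| "partial_sum Y y (Suc n) = partial_sum Y y n \<oplus>\<^bsub>Y\<^esub> y n"

lemma dual_zero:
  assumes ns: "is_normed_space Y" and g: "g \<in> dual Y"
  shows "g \<zero>\<^bsub>Y\<^esub> = 0"
  using dualD(2)[OF g ns_zero[OF ns], of 0] by (simp add: ns_scale_zero[OF ns])

lemma dual_minus:
  assumes ns: "is_normed_space Y" and g: "g \<in> dual Y" and "x \<in> carrier Y" "y \<in> carrier Y"
  shows "g (x \<ominus>\<^bsub>Y\<^esub> y) = g x - g y"
  using assms by (simp add: ns_minus_eq[OF ns] dualD[OF g] ns_scale[OF ns])

lemma partial_sum_closed:
  assumes ns: "is_normed_space Y" and "\<And>n. y n \<in> carrier Y"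
  shows "partial_sum Y y N \<in> carrier Y"
  by (induction N) (use assms in \<open>auto simp: ns_zero ns_add\<close>)

lemma dual_partial_sum:
  assumes ns: "is_normed_space Y" and g: "g \<in> dual Y" and y: "\<And>n. y n \<in> carrier Y"
  shows "g (partial_sum Y y N) = (\<Sum>n<N. g (y n))"
  by (induction N) (use partial_sum_closed[OF ns y] y in \<open>auto simp: dual_zero[OF ns g] dualD[OF g]\<close>)

lemma dual_tendsto:
  assumes ns: "is_normed_space Y" and g: "g \<in> dual Y"
    and s: "\<And>n. s n \<in> carrier Y" and l: "l \<in> carrier Y"
    and lim: "(\<lambda>n. vnorm Y (s n \<ominus>\<^bsub>Y\<^esub> l)) \<longlonglongrightarrow> 0"
  shows "(\<lambda>n. g (s n)) \<longlonglongrightarrow> g l"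
proof (rule LIM_zero_cancel)
  have le: "norm (g (s n) - g l) \<le> dual_norm Y g * vnorm Y (s n \<ominus>\<^bsub>Y\<^esub> l)" for n
    using dual_norm_bound(2)[OF ns g ns_minus[OF ns s l], of n] by (simp add: dual_minus[OF ns g s l])
  have "(\<lambda>n. dual_norm Y g * vnorm Y (s n \<ominus>\<^bsub>Y\<^esub> l)) \<longlonglongrightarrow> dual_norm Y g * 0"
    using lim by (rule tendsto_mult_left)
  then show "(\<lambda>n. g (s n) - g l) \<longlonglongrightarrow> 0"
    unfolding mult_zero_right by (rule Lim_null_comparison[OF always_eventually, OF allI, OF le])
qed

text \<open>Norm limits are weak limits, and functionals separate points.\<close>

lemma norm_limit_unique:
  assumes ns: "is_normed_space Y" and s: "\<And>n. s n \<in> carrier Y"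
    and l: "l \<in> carrier Y" "(\<lambda>n. vnorm Y (s n \<ominus>\<^bsub>Y\<^esub> l)) \<longlonglongrightarrow> 0"
    and m: "m \<in> carrier Y" "(\<lambda>n. vnorm Y (s n \<ominus>\<^bsub>Y\<^esub> m)) \<longlonglongrightarrow> 0"
  shows "l = m"
proof (rule ccontr)
  assume "l \<noteq> m"
  then obtain g where g: "g \<in> dual Y" "g l \<noteq> g m" by (rule dual_separates[OF ns l(1) m(1)])
  show False
    using LIMSEQ_unique[OF dual_tendsto[OF ns g(1) s l] dual_tendsto[OF ns g(1) s m]] g(2) by simp
qed

lemma sum_split_at:
  fixes f :: "nat \<Rightarrow> 'c::comm_monoid_add"
  assumes "N \<le> M"
  shows "(\<Sum>n<M. f n) = (\<Sum>n<N. f n) + (\<Sum>n\<in>{N..<M}. f n)"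
  using assms by (simp add: lessThan_atLeast0 sum.atLeastLessThan_concat)

lemma sum_if_split_at:
  fixes f g :: "nat \<Rightarrow> 'c::comm_monoid_add"
  assumes "N \<le> M"
  shows "(\<Sum>n<M. if n < N then f n else g n) = (\<Sum>n<N. f n) + (\<Sum>n\<in>{N..<M}. g n)"
  unfolding sum_split_at[OF assms] by (intro arg_cong2[where f = "(+)"] sum.cong) auto

section \<open>Coordinates in the \<open>\<ell>\<^sub>p\<close>-sum\<close>

definition coord_embedding :: "(nat \<Rightarrow> ('k, 'a) normed_space) \<Rightarrow> nat \<Rightarrow> 'a \<Rightarrow> nat \<Rightarrow> 'a" where
  "coord_embedding X n u = (\<lambda>m. if m = n then u else \<zero>\<^bsub>X m\<^esub>)"

definition coord_restriction :: "(nat \<Rightarrow> ('k, 'a) normed_space) \<Rightarrow> nat set \<Rightarrow> (nat \<Rightarrow> 'a) \<Rightarrow> nat \<Rightarrow> 'a" where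
  "coord_restriction X A x = (\<lambda>m. if m \<in> A then x m else \<zero>\<^bsub>X m\<^esub>)"

lemma lp_sum_simps:
  "\<zero>\<^bsub>lp_sum p X\<^esub> = (\<lambda>n. \<zero>\<^bsub>X n\<^esub>)" "x \<oplus>\<^bsub>lp_sum p X\<^esub> y = (\<lambda>n. x n \<oplus>\<^bsub>X n\<^esub> y n)" "a \<odot>\<^bsub>lp_sum p X\<^esub> x = (\<lambda>n. a \<odot>\<^bsub>X n\<^esub> x n)"
  by (simp_all add: lp_sum_def)

lemma in_lp_sum_iff:
  "x \<in> carrier (lp_sum p X) \<longleftrightarrow> (\<forall>n. x n \<in> carrier (X n)) \<and> summable (\<lambda>n. vnorm (X n) (x n) powr p)"
  by (simp add: lp_sum_def)

lemma lp_sum_coord: "x \<in> carrier (lp_sum p X) \<Longrightarrow> x n \<in> carrier (X n)"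
  by (simp add: in_lp_sum_iff)

lemma lp_norm_ge [simp]: "0 \<le> vnorm (lp_sum p X) x"
  by (simp add: lp_sum_def)

context
  fixes X :: "nat \<Rightarrow> ('k::real_or_complex, 'a) normed_space" and p :: real
  assumes ns: "\<And>n. is_normed_space (X n)" and p: "1 \<le> p"
begin

private abbreviation (input) "L \<equiv> lp_sum p X"

lemma lp_norm_powr:
  assumes "x \<in> carrier L"
  shows "vnorm L x powr p = (\<Sum>n. vnorm (X n) (x n) powr p)"
proof -
  have "0 \<le> (\<Sum>n. vnorm (X n) (x n) powr p)"
    using assms by (intro suminf_nonneg) (auto simp: in_lp_sum_iff)
  then show ?thesis using p by (simp add: lp_sum_def powr_powr)
qed

lemma le_lp_norm_iff:
  assumes "x \<in> carrier L" "0 \<le> c"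
  shows "c \<le> vnorm L x \<longleftrightarrow> c powr p \<le> (\<Sum>n. vnorm (X n) (x n) powr p)"
    and "vnorm L x \<le> c \<longleftrightarrow> (\<Sum>n. vnorm (X n) (x n) powr p) \<le> c powr p"
  unfolding lp_norm_powr[OF assms(1), symmetric]
  using p assms(2) lp_norm_ge[of p X x] powr_mono2[of p c "vnorm L x"] powr_mono2[of p "vnorm L x" c]
    powr_less_mono2[of p c "vnorm L x"] powr_less_mono2[of p "vnorm L x" c]
  by linarith+

lemma lp_coord_norm_le:
  assumes x: "x \<in> carrier L"
  shows "vnorm (X n) (x n) \<le> vnorm L x"
proof -
  have "(\<Sum>m\<in>{n}. vnorm (X m) (x m) powr p) \<le> (\<Sum>m. vnorm (X m) (x m) powr p)"
    using x by (intro sum_le_suminf) (auto simp: in_lp_sum_iff)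
  then show ?thesis using ns_norm_ge[OF ns lp_sum_coord[OF x]] by (subst le_lp_norm_iff[OF x]) auto
qed

lemma lp_sum_normed: "is_normed_space L"
proof -
  have Xg: "abelian_group (X n)" "module (scalar_field :: ('k, 'k) normed_space) (X n)" for n
    using ns[of n] by (auto simp: is_normed_space_def module_def)
  have add: "x \<oplus>\<^bsub>L\<^esub> y \<in> carrier L \<and> vnorm L (x \<oplus>\<^bsub>L\<^esub> y) \<le> vnorm L x + vnorm L y"
    if xy: "x \<in> carrier L" "y \<in> carrier L" for x y
  proof -
    have xyc: "x n \<in> carrier (X n)" "y n \<in> carrier (X n)" for n using xy by (auto simp: in_lp_sum_iff)
    note mink = minkowski_powr[of "\<lambda>n. vnorm (X n) (x n)" p "\<lambda>n. vnorm (X n) (y n)"]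
    have m: "summable (\<lambda>n. (vnorm (X n) (x n) + vnorm (X n) (y n)) powr p)"
      "(\<Sum>n. (vnorm (X n) (x n) + vnorm (X n) (y n)) powr p) powr (1 / p) \<le> vnorm L x + vnorm L y"
      using mink xy p by (auto simp: in_lp_sum_iff lp_sum_def ns_norm_ge[OF ns])
    have le: "vnorm (X n) (x n \<oplus>\<^bsub>X n\<^esub> y n) powr p \<le> (vnorm (X n) (x n) + vnorm (X n) (y n)) powr p" for n
      using ns_norm_triangle[OF ns xyc] ns_norm_ge[OF ns ns_add[OF ns xyc]] p by (intro powr_mono2) auto
    have s: "summable (\<lambda>n. vnorm (X n) (x n \<oplus>\<^bsub>X n\<^esub> y n) powr p)"
      by (rule summable_comparison_test'[OF m(1), of 0]) (use le in simp)
    have "(\<Sum>n. vnorm (X n) (x n \<oplus>\<^bsub>X n\<^esub> y n) powr p) powr (1 / p)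
        \<le> (\<Sum>n. (vnorm (X n) (x n) + vnorm (X n) (y n)) powr p) powr (1 / p)"
      using p s m(1) by (intro powr_mono2 suminf_le le suminf_nonneg) auto
    then show ?thesis using m(2) s xyc by (auto simp: lp_sum_def ns_add[OF ns])
  qed
  have scale: "a \<odot>\<^bsub>L\<^esub> x \<in> carrier L \<and> vnorm L (a \<odot>\<^bsub>L\<^esub> x) = norm a * vnorm L x"
    if x: "x \<in> carrier L" for a x
  proof -
    have xc: "x n \<in> carrier (X n)" for n using x by (auto simp: in_lp_sum_iff)
    have eq: "vnorm (X n) (a \<odot>\<^bsub>X n\<^esub> x n) powr p = norm a powr p * vnorm (X n) (x n) powr p" for n
      by (simp add: ns_norm_scale[OF ns xc] powr_mult)
    have s: "summable (\<lambda>n. vnorm (X n) (x n) powr p)" using x by (simp add: in_lp_sum_iff)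
    then have "(\<Sum>n. vnorm (X n) (a \<odot>\<^bsub>X n\<^esub> x n) powr p) powr (1 / p)
        = (norm a powr p) powr (1 / p) * (\<Sum>n. vnorm (X n) (x n) powr p) powr (1 / p)"
      unfolding eq by (simp add: suminf_mult powr_mult)
    moreover have "(norm a powr p) powr (1 / p) = norm a" using p by (simp add: powr_powr)
    ultimately have "vnorm L (a \<odot>\<^bsub>L\<^esub> x) = norm a * vnorm L x"
      by (simp add: lp_sum_def)
    moreover have "a \<odot>\<^bsub>L\<^esub> x \<in> carrier L"
      using s xc by (simp add: in_lp_sum_iff lp_sum_simps eq ns_scale[OF ns])
    ultimately show ?thesis by simp
  qed
  have zero: "\<zero>\<^bsub>L\<^esub> \<in> carrier L"
    by (simp add: in_lp_sum_iff lp_sum_simps ns_zero[OF ns] ns_norm_zero[OF ns])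
  have "abelian_group L"
  proof (rule abelian_groupI)
    show "x \<oplus>\<^bsub>L\<^esub> y \<in> carrier L" if "x \<in> carrier L" "y \<in> carrier L" for x y
      using add that by blast
    show "\<zero>\<^bsub>L\<^esub> \<in> carrier L" by (rule zero)
    show "x \<oplus>\<^bsub>L\<^esub> y \<oplus>\<^bsub>L\<^esub> z = x \<oplus>\<^bsub>L\<^esub> (y \<oplus>\<^bsub>L\<^esub> z)"
      if "x \<in> carrier L" "y \<in> carrier L" "z \<in> carrier L" for x y z
      using that by (auto simp: lp_sum_simps in_lp_sum_iff abelian_monoid.a_assoc[OF abelian_group.axioms(1)[OF Xg(1)]])
    show "x \<oplus>\<^bsub>L\<^esub> y = y \<oplus>\<^bsub>L\<^esub> x" if "x \<in> carrier L" "y \<in> carrier L" for x y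
      using that by (auto simp: lp_sum_simps in_lp_sum_iff abelian_monoid.a_comm[OF abelian_group.axioms(1)[OF Xg(1)]])
    show "\<zero>\<^bsub>L\<^esub> \<oplus>\<^bsub>L\<^esub> x = x" if "x \<in> carrier L" for x
      using that by (auto simp: lp_sum_simps in_lp_sum_iff abelian_monoid.l_zero[OF abelian_group.axioms(1)[OF Xg(1)]])
    show "\<exists>y\<in>carrier L. y \<oplus>\<^bsub>L\<^esub> x = \<zero>\<^bsub>L\<^esub>" if x: "x \<in> carrier L" for x
    proof (rule bexI[of _ "(- 1) \<odot>\<^bsub>L\<^esub> x"])
      have "(- 1) \<odot>\<^bsub>X n\<^esub> x n \<oplus>\<^bsub>X n\<^esub> x n = \<zero>\<^bsub>X n\<^esub>" for n
        using ns_add_scale[OF ns lp_sum_coord[OF x], where a = "- 1" and b = 1]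
        by (simp add: ns_one[OF ns lp_sum_coord[OF x]] ns_scale_0[OF ns lp_sum_coord[OF x]])
      then show "(- 1) \<odot>\<^bsub>L\<^esub> x \<oplus>\<^bsub>L\<^esub> x = \<zero>\<^bsub>L\<^esub>" by (simp add: lp_sum_simps)
    qed (use scale x in blast)
  qed
  then have "module (scalar_field :: ('k, 'k) normed_space) L"
  proof (intro moduleI cring_scalar_field)
    show "a \<odot>\<^bsub>L\<^esub> x \<in> carrier L" if "x \<in> carrier L" for a :: 'k and x using scale that by blast
  qed (auto simp: lp_sum_simps in_lp_sum_iff ns_scale_add[OF ns] ns_add_scale[OF ns]
      ns_scale_scale[OF ns] ns_one[OF ns])
  moreover have "vnorm L x = 0 \<longleftrightarrow> x = \<zero>\<^bsub>L\<^esub>" if x: "x \<in> carrier L" for x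
  proof
    assume "vnorm L x = 0"
    then have "vnorm (X n) (x n) = 0" for n
      using lp_coord_norm_le[OF x, of n] ns_norm_ge[OF ns lp_sum_coord[OF x], of n] by simp
    then show "x = \<zero>\<^bsub>L\<^esub>" by (auto simp: lp_sum_simps ns_norm_eq[OF ns lp_sum_coord[OF x]])
  qed (simp add: lp_sum_def ns_norm_zero[OF ns])
  ultimately show ?thesis
    unfolding is_normed_space_def using add scale lp_norm_ge by blast
qed

lemma finitely_supported_in_lp_sum:
  assumes "\<And>n. x n \<in> carrier (X n)" "finite A" "\<And>n. n \<notin> A \<Longrightarrow> x n = \<zero>\<^bsub>X n\<^esub>"
  shows "x \<in> carrier L" "vnorm L x powr p = (\<Sum>n\<in>A. vnorm (X n) (x n) powr p)"
proof -
  have 0: "vnorm (X n) (x n) powr p = 0" if "n \<notin> A" for n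
    using assms(3)[OF that] by (simp add: ns_norm_zero[OF ns])
  then show x: "x \<in> carrier L"
    using assms(1) by (simp add: in_lp_sum_iff summable_finite[OF assms(2) 0])
  show "vnorm L x powr p = (\<Sum>n\<in>A. vnorm (X n) (x n) powr p)"
    unfolding lp_norm_powr[OF x] by (rule suminf_finite[OF assms(2) 0])
qed

lemma coord_embedding_norm:
  assumes u: "u \<in> carrier (X n)"
  shows "coord_embedding X n u \<in> carrier L" "vnorm L (coord_embedding X n u) = vnorm (X n) u"
proof -
  note e = finitely_supported_in_lp_sum[of "coord_embedding X n u" "{n}"]
  have s: "coord_embedding X n u \<in> carrier L" "vnorm L (coord_embedding X n u) powr p = vnorm (X n) u powr p"
    using u e by (simp_all add: coord_embedding_def ns_zero[OF ns])
  show "coord_embedding X n u \<in> carrier L" by (rule s)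
  have "vnorm L (coord_embedding X n u) = (vnorm L (coord_embedding X n u) powr p) powr (1 / p)"
    using p by (simp add: powr_powr)
  also have "\<dots> = vnorm (X n) u"
    unfolding s(2) using p ns_norm_ge[OF ns u] by (simp add: powr_powr)
  finally show "vnorm L (coord_embedding X n u) = vnorm (X n) u" .
qed

lemma coord_embedding_operator: "bounded_operator (X n) L (coord_embedding X n)"
  unfolding bounded_operator_def
proof (intro conjI ballI allI exI[of _ 1] funcsetI)
  show "coord_embedding X n u \<in> carrier L" "vnorm L (coord_embedding X n u) \<le> 1 * vnorm (X n) u"
    if "u \<in> carrier (X n)" for u
    using coord_embedding_norm[OF that] by simp_all
qed (auto simp: coord_embedding_def lp_sum_simps ns_scale_zero[OF ns] fun_eq_iff
    ns_zero_add[OF ns] ns_zero[OF ns])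

lemma projection_operator: "bounded_operator L (X n) (\<lambda>x. x n)"
  unfolding bounded_operator_def
  by (auto simp: lp_sum_simps lp_sum_coord intro!: exI[of _ 1] lp_coord_norm_le)

lemma coord_restriction_in_lp_sum:
  assumes x: "x \<in> carrier L"
  shows "coord_restriction X A x \<in> carrier L"
    and "vnorm L (coord_restriction X A x) \<le> vnorm L x"
proof -
  have le: "vnorm (X n) (coord_restriction X A x n) powr p \<le> vnorm (X n) (x n) powr p" for n
    by (simp add: coord_restriction_def ns_norm_zero[OF ns])
  have s: "summable (\<lambda>n. vnorm (X n) (x n) powr p)" using x by (simp add: in_lp_sum_iff)
  show t: "coord_restriction X A x \<in> carrier L"
    unfolding in_lp_sum_iff
    using x s le by (auto simp: coord_restriction_def in_lp_sum_iff ns_zero[OF ns]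
        intro!: summable_comparison_test'[OF s, of 0])
  show "vnorm L (coord_restriction X A x) \<le> vnorm L x"
    using s t le by (subst le_lp_norm_iff[OF t lp_norm_ge])
      (auto simp: lp_norm_powr[OF x] in_lp_sum_iff intro!: suminf_le)
qed

lemma coord_restriction_norm:
  assumes "x \<in> carrier L" "finite A"
  shows "vnorm L (coord_restriction X A x) powr p = (\<Sum>n\<in>A. vnorm (X n) (x n) powr p)"
  using finitely_supported_in_lp_sum(2)[of "coord_restriction X A x" A] assms
  by (simp add: coord_restriction_def in_lp_sum_iff ns_zero[OF ns])

lemma coord_restriction_Un:
  assumes "x \<in> carrier L" "A \<inter> B = {}"
  shows "coord_restriction X (A \<union> B) x = coord_restriction X A x \<oplus>\<^bsub>L\<^esub> coord_restriction X B x"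
proof
  fix n
  interpret module "scalar_field :: ('k, 'k) normed_space" "X n"
    using ns by (simp add: is_normed_space_def)
  show "coord_restriction X (A \<union> B) x n = (coord_restriction X A x \<oplus>\<^bsub>L\<^esub> coord_restriction X B x) n"
    using assms by (auto simp: coord_restriction_def lp_sum_simps lp_sum_coord)
qed

lemma coord_restriction_empty: "coord_restriction X {} x = \<zero>\<^bsub>L\<^esub>"
  and coord_restriction_UNIV: "coord_restriction X UNIV x = x"
  and coord_restriction_singleton: "coord_restriction X {n} x = coord_embedding X n (x n)"
  by (auto simp: coord_restriction_def lp_sum_simps coord_embedding_def)

lemma coord_restriction_tail_tendsto_0:
  assumes x: "x \<in> carrier L"
  shows "(\<lambda>N. vnorm L (coord_restriction X {N..} x)) \<longlonglongrightarrow> 0"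
proof -
  let ?s = "\<lambda>n. vnorm (X n) (x n) powr p"
  have s: "summable ?s" using x by (simp add: in_lp_sum_iff)
  have eq: "vnorm L (coord_restriction X {N..} x) = (suminf ?s - sum ?s {..<N}) powr (1 / p)" for N
  proof -
    note tr = coord_restriction_in_lp_sum(1)[OF x]
    have "(\<Sum>n. vnorm (X n) (coord_restriction X {N..} x n) powr p)
        = (\<Sum>n. vnorm (X (n + N)) (coord_restriction X {N..} x (n + N)) powr p)
          + (\<Sum>n<N. vnorm (X n) (coord_restriction X {N..} x n) powr p)"
      using tr[of "{N..}"] by (intro suminf_split_initial_segment) (simp add: in_lp_sum_iff)
    also have "\<dots> = (\<Sum>n. ?s (n + N))" by (simp add: coord_restriction_def ns_norm_zero[OF ns])
    also have "\<dots> = suminf ?s - sum ?s {..<N}" by (rule suminf_minus_initial_segment[OF s])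
    finally show ?thesis by (simp add: lp_sum_def)
  qed
  have "(\<lambda>N. suminf ?s - sum ?s {..<N}) \<longlonglongrightarrow> suminf ?s - suminf ?s"
    using s by (intro tendsto_diff tendsto_const summable_LIMSEQ)
  then have "(\<lambda>N. suminf ?s - sum ?s {..<N}) \<longlonglongrightarrow> 0" by simp
  moreover have "\<forall>\<^sub>F N in sequentially. 0 \<le> suminf ?s - sum ?s {..<N}"
    using s by (intro always_eventually allI) (simp add: sum_le_suminf)
  ultimately have "(\<lambda>N. (suminf ?s - sum ?s {..<N}) powr (1 / p)) \<longlonglongrightarrow> 0 powr (1 / p)"
    using p by (intro tendsto_powr2 tendsto_const) auto
  then show ?thesis unfolding eq by simp
qed

lemma dual_coord_restriction:
  assumes h: "h \<in> dual L" and x: "x \<in> carrier L" and A: "finite A"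
  shows "h (coord_restriction X A x) = (\<Sum>n\<in>A. h (coord_embedding X n (x n)))"
  using A
proof induction
  case empty
  then show ?case by (simp add: coord_restriction_empty dual_zero[OF lp_sum_normed h])
next
  case (insert n A)
  then have "coord_restriction X (insert n A) x = coord_restriction X {n} x \<oplus>\<^bsub>L\<^esub> coord_restriction X A x"
    using coord_restriction_Un[OF x, of "{n}" A] by simp
  then show ?case
    using insert coord_restriction_in_lp_sum(1)[OF x, of "{n}"] coord_restriction_in_lp_sum(1)[OF x, of A]
    by (simp add: dualD[OF h] coord_restriction_singleton)
qed

lemma coord_restriction_operator_partial_sum:
  assumes Y: "is_normed_space Y" and T: "bounded_operator L Y T" and x: "x \<in> carrier L"
  shows "T (coord_restriction X {..<N} x) = partial_sum Y (\<lambda>n. T (coord_embedding X n (x n))) N"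
proof (induction N)
  case 0
  have "T (0 \<odot>\<^bsub>L\<^esub> x) = 0 \<odot>\<^bsub>Y\<^esub> T x" "T x \<in> carrier Y"
    using T x by (auto simp: bounded_operator_def)
  then show ?case
    by (simp add: coord_restriction_empty ns_scale_0[OF lp_sum_normed x] ns_scale_0[OF Y])
next
  case (Suc N)
  have "coord_restriction X {..<Suc N} x
      = coord_restriction X {..<N} x \<oplus>\<^bsub>L\<^esub> coord_restriction X {N} x"
    using coord_restriction_Un[OF x, of "{..<N}" "{N}"] by (simp add: lessThan_Suc)
  then have "T (coord_restriction X {..<Suc N} x)
      = T (coord_restriction X {..<N} x) \<oplus>\<^bsub>Y\<^esub> T (coord_restriction X {N} x)"
    using T coord_restriction_in_lp_sum(1)[OF x] by (simp add: bounded_operator_def)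
  then show ?case by (simp add: Suc coord_restriction_singleton)
qed

text \<open>The restrictions of \<open>x\<close> to initial segments converge to \<open>x\<close> in norm, as \<open>p < \<infinity>\<close>.\<close>

lemma operator_series:
  assumes Y: "is_normed_space Y" and T: "bounded_operator L Y T" and x: "x \<in> carrier L"
  shows "(\<lambda>N. vnorm Y (partial_sum Y (\<lambda>n. T (coord_embedding X n (x n))) N \<ominus>\<^bsub>Y\<^esub> T x)) \<longlonglongrightarrow> 0"
proof -
  obtain C where C: "0 < C" "\<And>x. x \<in> carrier L \<Longrightarrow> vnorm Y (T x) \<le> C * vnorm L x"
    using bounded_operator_bound[OF T lp_sum_normed] by blast
  note tr = coord_restriction_in_lp_sum(1)[OF x]
  have Tc: "T x \<in> carrier Y" if "x \<in> carrier L" for x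
    using T that by (auto simp: bounded_operator_def)
  define S where "S N = T (coord_restriction X {..<N} x)" for N
  have Sc: "S N \<in> carrier Y" for N unfolding S_def by (rule Tc[OF tr])
  have le: "vnorm Y (S N \<ominus>\<^bsub>Y\<^esub> T x) \<le> C * vnorm L (coord_restriction X {N..} x)" for N
  proof -
    have split: "{..<N} \<union> {N..} = UNIV" "{..<N} \<inter> {N..} = {}" by auto
    have "x = coord_restriction X {..<N} x \<oplus>\<^bsub>L\<^esub> coord_restriction X {N..} x"
      by (rule coord_restriction_Un[OF x split(2), unfolded split(1) coord_restriction_UNIV])
    then have "T x = S N \<oplus>\<^bsub>Y\<^esub> T (coord_restriction X {N..} x)"
      unfolding S_def using T tr by (metis bounded_operator_def)
    moreover have "vnorm Y ((y \<oplus>\<^bsub>Y\<^esub> z) \<ominus>\<^bsub>Y\<^esub> y) = vnorm Y z" if "y \<in> carrier Y" "z \<in> carrier Y" for y z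
    proof -
      interpret module "scalar_field :: ('k, 'k) normed_space" Y
        using Y by (simp add: is_normed_space_def)
      have "y \<oplus>\<^bsub>Y\<^esub> z = z \<oplus>\<^bsub>Y\<^esub> y" using that by (rule M.a_comm)
      then have "(y \<oplus>\<^bsub>Y\<^esub> z) \<ominus>\<^bsub>Y\<^esub> y = z" using that by (simp add: M.a_assoc a_minus_def M.r_neg)
      then show ?thesis by simp
    qed
    ultimately have "vnorm Y (T x \<ominus>\<^bsub>Y\<^esub> S N) = vnorm Y (T (coord_restriction X {N..} x))"
      using Sc Tc[OF tr] by simp
    then show ?thesis
      using C(2)[OF tr] ns_norm_minus_commute[OF Y Sc Tc[OF x]] by simp
  qed
  have ge: "0 \<le> vnorm Y (S N \<ominus>\<^bsub>Y\<^esub> T x)" for N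
    by (rule ns_norm_ge[OF Y ns_minus[OF Y Sc Tc[OF x]]])
  have "(\<lambda>N. C * vnorm L (coord_restriction X {N..} x)) \<longlonglongrightarrow> C * 0"
    by (intro tendsto_mult_left coord_restriction_tail_tendsto_0 x)
  then have lim: "(\<lambda>N. C * vnorm L (coord_restriction X {N..} x)) \<longlonglongrightarrow> 0" by simp
  have "(\<lambda>N. vnorm Y (S N \<ominus>\<^bsub>Y\<^esub> T x)) \<longlonglongrightarrow> 0"
    by (rule tendsto_sandwich[OF always_eventually[OF allI, OF ge] always_eventually[OF allI, OF le]
          tendsto_const lim])
  then show ?thesis by (simp add: S_def coord_restriction_operator_partial_sum[OF Y T x])
qed

section \<open>Functionals on the sum have small tails\<close>

text \<open>
  Otherwise there would be \<open>K\<close> disjointly supported vectors of norm at most \<open>1\<close>, each with a value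
  under \<open>h\<close> of modulus larger than \<open>e\<close>, and, after multiplication by scalars of modulus \<open>1\<close>, with
  positive real values. Their sum \<open>x\<close> has
  \<open>\<parallel>x\<parallel> \<le> K\<^bsup>1/p\<^esup>\<close>, whereas \<open>h x \<ge> K * e\<close>. For large \<open>K\<close> this contradicts boundedness of \<open>h\<close>,
  since \<open>1 / p < 1\<close>.
\<close>

lemma functional_tails_vanish:
  assumes p1: "1 < p" and h: "h \<in> dual L" and e: "0 < e"
  shows "\<exists>N. \<forall>M\<ge>N. \<forall>x\<in>unit_ball L. norm (h (coord_restriction X {N..<M} x)) \<le> e"
proof (rule ccontr)
  assume neg: "\<not> ?thesis"
  then have "\<forall>N. \<exists>M x. N \<le> M \<and> x \<in> unit_ball L \<and> e < norm (h (coord_restriction X {N..<M} x))"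
    by (simp add: not_le Bex_def)
  then obtain M z where Mz: "\<And>N. N \<le> M N" "\<And>N. z N \<in> unit_ball L"
    "\<And>N. e < norm (h (coord_restriction X {N..<M N} (z N)))" by metis
  \<comment> \<open>The sum of the first \<open>K\<close> blocks. Its vanishing from \<open>N\<close> on allows the next block to be put behind it.\<close>
  have blocks: "\<exists>N x c. x \<in> carrier L \<and> (\<forall>n\<ge>N. x n = \<zero>\<^bsub>X n\<^esub>) \<and> h x = of_real c \<and> real K * e \<le> c
      \<and> vnorm L x powr p \<le> real K" for K
  proof (induction K)
    case 0
    show ?case
    proof (intro exI[of _ 0] exI[of _ "\<zero>\<^bsub>L\<^esub>"] conjI allI impI)
      show "\<zero>\<^bsub>L\<^esub> n = \<zero>\<^bsub>X n\<^esub>" for n by (simp add: lp_sum_simps)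
    qed (use p in \<open>simp_all add: ns_zero[OF lp_sum_normed] dual_zero[OF lp_sum_normed h]
          ns_norm_zero[OF lp_sum_normed]\<close>)
  next
    case (Suc K)
    then obtain N x c where x: "x \<in> carrier L" "\<And>n. n \<ge> N \<Longrightarrow> x n = \<zero>\<^bsub>X n\<^esub>"
      "h x = of_real c" "real K * e \<le> c" "vnorm L x powr p \<le> real K" by auto
    define w where "w = coord_restriction X {N..<M N} (z N)"
    have zc: "z N \<in> carrier L" "vnorm L (z N) \<le> 1" using Mz(2)[of N] by (auto simp: unit_ball_def)
    have w: "w \<in> carrier L" "e < norm (h w)" "vnorm L w powr p \<le> 1"
      using coord_restriction_in_lp_sum[OF zc(1), of "{N..<M N}"] Mz(3)[of N] zc(2) p
        powr_mono2[of p "vnorm L w" 1] by (simp_all add: w_def)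
    \<comment> \<open>The unimodular scalar that turns \<open>h w\<close> into a positive real.\<close>
    define u where "u = of_real (norm (h w)) / h w"
    have u: "norm u = 1" "u * h w = of_real (norm (h w))"
      using w(2) e by (auto simp: u_def norm_divide)
    define x' where "x' = x \<oplus>\<^bsub>L\<^esub> u \<odot>\<^bsub>L\<^esub> w"
    have x'c: "x' \<in> carrier L"
      using x(1) w(1) by (simp add: x'_def ns_add[OF lp_sum_normed] ns_scale[OF lp_sum_normed])
    have hx': "h x' = of_real (c + norm (h w))"
      using x w u by (simp add: x'_def dualD[OF h] ns_scale[OF lp_sum_normed])
    have coords: "vnorm (X n) (x' n) powr p
        = vnorm (X n) (x n) powr p + vnorm (X n) (w n) powr p" for n
    proof (cases "n < N")
      case True
      then have wn: "w n = \<zero>\<^bsub>X n\<^esub>" by (simp add: w_def coord_restriction_def)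
      then have "x' n = x n"
        using lp_sum_coord[OF x(1), of n]
        by (simp add: x'_def lp_sum_simps ns_zero_add[OF ns] ns_scale_zero[OF ns])
      then show ?thesis using wn p by (simp add: ns_norm_zero[OF ns])
    next
      case False
      then have xn: "x n = \<zero>\<^bsub>X n\<^esub>" using x(2) by simp
      then have "x' n = u \<odot>\<^bsub>X n\<^esub> w n"
        using lp_sum_coord[OF w(1), of n]
        by (simp add: x'_def lp_sum_simps ns_zero_add[OF ns] ns_scale[OF ns])
      then show ?thesis
        using xn lp_sum_coord[OF w(1), of n] p u(1)
        by (simp add: ns_norm_scale[OF ns] ns_norm_zero[OF ns])
    qed
    have "vnorm L x' powr p = vnorm L x powr p + vnorm L w powr p"
      unfolding lp_norm_powr[OF x'c] lp_norm_powr[OF x(1)] lp_norm_powr[OF w(1)] coords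
      using x(1) w(1) by (intro suminf_add[symmetric]) (auto simp: in_lp_sum_iff)
    then have "vnorm L x' powr p \<le> real (Suc K)" using x(5) w(3) by simp
    moreover have "x' n = \<zero>\<^bsub>X n\<^esub>" if "n \<ge> M N" for n
      using that Mz(1)[of N] x(2)[of n]
      by (simp add: x'_def lp_sum_simps w_def coord_restriction_def ns_scale_zero[OF ns]
          ns_zero_add[OF ns] ns_zero[OF ns])
    moreover have "real (Suc K) * e \<le> c + norm (h w)"
      using x(4) w(2) by (simp add: algebra_simps)
    ultimately show ?case using x'c hx' by blast
  qed
  obtain C where C: "0 < C" "\<And>x. x \<in> carrier L \<Longrightarrow> norm (h x) \<le> C * vnorm L x"
  proof -
    have "norm (h x) \<le> (dual_norm L h + 1) * vnorm L x" if "x \<in> carrier L" for x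
      using dual_norm_bound(2)[OF lp_sum_normed h that] by (simp add: algebra_simps add_increasing)
    then show thesis using dual_norm_bound(1)[OF lp_sum_normed h] by (intro that[of "dual_norm L h + 1"]) auto
  qed
  have bound: "real K powr (1 - 1 / p) \<le> C / e" if "0 < K" for K
  proof -
    obtain x c where x: "x \<in> carrier L" "h x = of_real c" "real K * e \<le> c" "vnorm L x powr p \<le> real K"
      using blocks[of K] by blast
    have "vnorm L x = (vnorm L x powr p) powr (1 / p)" using p lp_norm_ge by (simp add: powr_powr)
    also have "\<dots> \<le> real K powr (1 / p)" using x(4) p by (intro powr_mono2) auto
    finally have "C * vnorm L x \<le> C * real K powr (1 / p)" using C(1) by simp
    then have "real K * e \<le> C * real K powr (1 / p)" using C(2)[OF x(1)] x(2,3) by simp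
    moreover have "real K = real K powr (1 - 1 / p) * real K powr (1 / p)"
      using that by (simp add: powr_add[symmetric])
    ultimately have "(real K powr (1 - 1 / p) * e) * real K powr (1 / p) \<le> C * real K powr (1 / p)"
      by (metis mult.assoc mult.commute)
    then have "real K powr (1 - 1 / p) * e \<le> C" using that by simp
    then show ?thesis using e by (simp add: pos_le_divide_eq)
  qed
  obtain K where K: "(C / e) powr (1 / (1 - 1 / p)) < real K" using reals_Archimedean2 by blast
  have "C / e = ((C / e) powr (1 / (1 - 1 / p))) powr (1 - 1 / p)"
    using C e p1 by (simp add: powr_powr)
  also have "\<dots> < real K powr (1 - 1 / p)" using K p1 by (intro powr_less_mono2) auto
  finally have "C / e < real K powr (1 - 1 / p)" .
  moreover have "0 < K" using le_less_trans[OF powr_ge_zero K] by simp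
  ultimately show False using bound[of K] by simp
qed

end

section \<open>Weak compactness is decided on the coordinates\<close>

context
  fixes X :: "nat \<Rightarrow> ('k::real_or_complex, 'a) normed_space" and p :: real
    and Y :: "('k, 'b) normed_space" and T :: "(nat \<Rightarrow> 'a) \<Rightarrow> 'b"
  assumes ns: "\<And>n. is_normed_space (X n)" and p: "1 < p"
    and Y: "is_banach_space Y" and T: "bounded_operator (lp_sum p X) Y T"
begin

private lemma p1: "1 \<le> p" using p by simp

private lemma nY: "is_normed_space Y" using Y by (simp add: is_banach_space_def)

private abbreviation (input) "Lp \<equiv> lp_sum p X"
private abbreviation (input) "TE \<equiv> \<lambda>x n. T (coord_embedding X n (x n))"

text \<open>
  The bipolar, within the sequences in \<open>Y\<close>, of the set of all \<open>(T\<^sub>n x\<^sub>n)\<^sub>n\<close> with \<open>x\<close> in the unit ball,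
  with respect to the duality with finite sequences of functionals on \<open>Y\<close>. Here \<open>T\<^sub>n\<close> is \<open>T\<close>
  restricted to the \<open>n\<close>-th coordinate space. The hull takes the place of the set of sequences
  \<open>(T\<^sub>n\<^sup>*\<^sup>* x\<^sub>n)\<^sub>n\<close> with \<open>x\<close> in the unit ball of the bidual of the sum.
\<close>

definition polar_hull :: "(nat \<Rightarrow> 'b) set" where
  "polar_hull = {y. (\<forall>n. y n \<in> carrier Y) \<and>
     (\<forall>N g c. (\<forall>n. g n \<in> dual Y) \<longrightarrow>
        (\<forall>x\<in>unit_ball Lp. norm (\<Sum>n<N. g n (TE x n)) \<le> c) \<longrightarrow> norm (\<Sum>n<N. g n (y n)) \<le> c)}"

private lemma TE_carrier: "x \<in> carrier Lp \<Longrightarrow> TE x n \<in> carrier Y"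
  using bounded_operator_compose[OF coord_embedding_operator[OF ns p1] T ns lp_sum_normed[OF ns p1], of n]
    lp_sum_coord[of x p X n]
  by (auto simp: bounded_operator_def)

lemma polar_hull_carrier: "y \<in> polar_hull \<Longrightarrow> y n \<in> carrier Y"
  by (simp add: polar_hull_def)

lemma polar_hullD:
  assumes "y \<in> polar_hull" "\<And>n. g n \<in> dual Y"
    "\<And>x. x \<in> unit_ball Lp \<Longrightarrow> norm (\<Sum>n<N. g n (TE x n)) \<le> c"
  shows "norm (\<Sum>n<N. g n (y n)) \<le> c"
  using assms unfolding polar_hull_def by simp

lemma image_in_polar_hull: "x \<in> unit_ball Lp \<Longrightarrow> TE x \<in> polar_hull"
  using TE_carrier by (auto simp: polar_hull_def unit_ball_def)

private lemma block_sum: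
  assumes g: "g \<in> dual Y" and x: "x \<in> carrier Lp"
  shows "(\<Sum>n\<in>{N..<M}. g (TE x n)) = g (T (coord_restriction X {N..<M} x))"
  using dual_coord_restriction[OF ns p1 dual_compose[OF T g lp_sum_normed[OF ns p1] nY] x, of "{N..<M}"]
  by simp

text \<open>
  If the partial sums were not Cauchy, there would be disjoint blocks on which the sum of \<open>y\<close> has norm
  at least \<open>d\<close>. Take a norming functional for each of \<open>K\<close> such blocks: they add up to at least
  \<open>K * d\<close> on \<open>y\<close>. On \<open>(T\<^sub>n x\<^sub>n)\<^sub>n\<close> with \<open>x\<close> in the unit ball they contribute at most \<open>C * \<parallel>x\<^sub>B\<parallel>\<close> for each
  block \<open>B\<close>, so by \<open>le_linear_plus_powr\<close> at most \<open>C * (K * e + D)\<close> in total. This bound is inherited by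
  \<open>y\<close>, and the choice \<open>e = d / (2 * C)\<close> makes it smaller than \<open>K * d\<close> for large \<open>K\<close>.
\<close>

lemma polar_hull_partial_sums_cauchy:
  assumes y: "y \<in> polar_hull" and d: "0 < d"
  shows "\<exists>N. \<forall>M\<ge>N. vnorm Y (partial_sum Y y M \<ominus>\<^bsub>Y\<^esub> partial_sum Y y N) < d"
proof (rule ccontr)
  assume neg: "\<not> ?thesis"
  let ?S = "partial_sum Y y"
  have Sc: "?S N \<in> carrier Y" for N by (rule partial_sum_closed[OF nY polar_hull_carrier[OF y]])
  obtain M where M: "\<And>N. N \<le> M N" "\<And>N. d \<le> vnorm Y (?S (M N) \<ominus>\<^bsub>Y\<^esub> ?S N)"
    using neg by (metis not_le)
  obtain C where C: "0 < C" "\<And>x. x \<in> carrier Lp \<Longrightarrow> vnorm Y (T x) \<le> C * vnorm Lp x"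
    using bounded_operator_bound[OF T lp_sum_normed[OF ns p1]] by blast
  define e where "e = d / (2 * C)"
  have e: "0 < e" using d C by (simp add: e_def)
  define D where "D = e powr (1 - p)"
  \<comment> \<open>The functionals of the first \<open>K\<close> blocks, which lie below \<open>N\<close>; the sum of \<open>p\<close>-th powers on the
    right is additive over the blocks, which is why the bound is kept in this linear form.\<close>
  have blocks: "\<exists>N g c. (\<forall>n. g n \<in> dual Y) \<and> (\<Sum>n<N. g n (y n)) = of_real c \<and> real K * d \<le> c \<and>
      (\<forall>x\<in>carrier Lp. norm (\<Sum>n<N. g n (TE x n))
         \<le> C * (real K * e + D * (\<Sum>n<N. vnorm (X n) (x n) powr p)))" for K
  proof (induction K)
    case 0
    show ?case
      by (intro exI[of _ 0] exI[of _ "\<lambda>_ _. 0"]) (simp add: dualI[of _ _ 0])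
  next
    case (Suc K)
    then obtain N g c where g: "\<And>n. g n \<in> dual Y" "(\<Sum>n<N. g n (y n)) = of_real c" "real K * d \<le> c"
      "\<And>x. x \<in> carrier Lp \<Longrightarrow> norm (\<Sum>n<N. g n (TE x n))
         \<le> C * (real K * e + D * (\<Sum>n<N. vnorm (X n) (x n) powr p))" by blast
    obtain G where G: "G \<in> dual Y" "\<And>u. u \<in> carrier Y \<Longrightarrow> norm (G u) \<le> vnorm Y u"
      "G (?S (M N) \<ominus>\<^bsub>Y\<^esub> ?S N) = of_real (vnorm Y (?S (M N) \<ominus>\<^bsub>Y\<^esub> ?S N))"
      using norming_functional[OF nY ns_minus[OF nY Sc[of "M N"] Sc[of N]]] by blast
    define g' where "g' n = (if n < N then g n else G)" for n
    have g'_app: "g' n u = (if n < N then g n u else G u)" for n u by (simp add: g'_def)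
    have "G (?S (M N) \<ominus>\<^bsub>Y\<^esub> ?S N) = (\<Sum>n<M N. G (y n)) - (\<Sum>n<N. G (y n))"
      by (simp add: dual_minus[OF nY G(1) Sc Sc] dual_partial_sum[OF nY G(1) polar_hull_carrier[OF y]])
    also have "\<dots> = (\<Sum>n\<in>{N..<M N}. G (y n))" by (simp add: sum_split_at[OF M(1)])
    finally have "(\<Sum>n<M N. g' n (y n)) = of_real (c + vnorm Y (?S (M N) \<ominus>\<^bsub>Y\<^esub> ?S N))"
      unfolding g'_app sum_if_split_at[OF M(1)] using G(3) g(2) by simp
    moreover have "real (Suc K) * d \<le> c + vnorm Y (?S (M N) \<ominus>\<^bsub>Y\<^esub> ?S N)"
      using g(3) M(2)[of N] by (simp add: algebra_simps)
    moreover have "norm (\<Sum>n<M N. g' n (TE x n))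
        \<le> C * (real (Suc K) * e + D * (\<Sum>n<M N. vnorm (X n) (x n) powr p))" if x: "x \<in> carrier Lp" for x
    proof -
      let ?B = "coord_restriction X {N..<M N} x"
      have B: "?B \<in> carrier Lp" by (rule coord_restriction_in_lp_sum(1)[OF ns p1 x])
      have "T ?B \<in> carrier Y" using T B by (auto simp: bounded_operator_def)
      then have "norm (\<Sum>n\<in>{N..<M N}. G (TE x n)) \<le> C * vnorm Lp ?B"
        unfolding block_sum[OF G(1) x] using G(2) C(2)[OF B] order_trans by blast
      also have "\<dots> \<le> C * (e + D * vnorm Lp ?B powr p)"
        unfolding D_def using C(1) e p by (intro mult_left_mono le_linear_plus_powr lp_norm_ge) auto
      also have "vnorm Lp ?B powr p = (\<Sum>n\<in>{N..<M N}. vnorm (X n) (x n) powr p)"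
        by (rule coord_restriction_norm[OF ns p1 x]) simp
      finally have "norm (\<Sum>n<M N. g' n (TE x n))
          \<le> C * (real K * e + D * (\<Sum>n<N. vnorm (X n) (x n) powr p))
            + C * (e + D * (\<Sum>n\<in>{N..<M N}. vnorm (X n) (x n) powr p))"
        unfolding g'_app sum_if_split_at[OF M(1)] using g(4)[OF x] by (intro norm_triangle_le add_mono)
      also have "\<dots> = C * (real (Suc K) * e + D * (\<Sum>n<M N. vnorm (X n) (x n) powr p))"
        by (simp add: sum_split_at[OF M(1)] algebra_simps)
      finally show ?thesis .
    qed
    moreover have "g' n \<in> dual Y" for n using g(1) G(1) by (simp add: g'_def)
    ultimately show ?case by blast
  qed
  have bound: "real K * d \<le> 2 * C * D" for K
  proof -
    obtain N g c where g: "\<And>n. g n \<in> dual Y" "(\<Sum>n<N. g n (y n)) = of_real c" "real K * d \<le> c"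
      "\<And>x. x \<in> carrier Lp \<Longrightarrow> norm (\<Sum>n<N. g n (TE x n))
         \<le> C * (real K * e + D * (\<Sum>n<N. vnorm (X n) (x n) powr p))" using blocks[of K] by blast
    have "norm (\<Sum>n<N. g n (y n)) \<le> C * (real K * e + D)"
    proof (rule polar_hullD[OF y g(1)])
      fix x assume "x \<in> unit_ball Lp"
      then have x: "x \<in> carrier Lp" "vnorm Lp x \<le> 1" by (auto simp: unit_ball_def)
      have "(\<Sum>n<N. vnorm (X n) (x n) powr p) \<le> (\<Sum>n. vnorm (X n) (x n) powr p)"
        using x by (intro sum_le_suminf) (auto simp: in_lp_sum_iff)
      also have "\<dots> \<le> 1" using le_lp_norm_iff(2)[OF ns p1 x(1), of 1] x(2) by simp
      finally have "D * (\<Sum>n<N. vnorm (X n) (x n) powr p) \<le> D * 1"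
        by (rule mult_left_mono) (simp add: D_def)
      then have "C * (real K * e + D * (\<Sum>n<N. vnorm (X n) (x n) powr p)) \<le> C * (real K * e + D)"
        using C(1) by simp
      with g(4)[OF x(1)] show "norm (\<Sum>n<N. g n (TE x n)) \<le> C * (real K * e + D)" by (rule order_trans)
    qed
    then have "real K * d \<le> C * (real K * e + D)" using g(2,3) by simp
    also have "\<dots> = real K * d / 2 + C * D" using C(1) by (simp add: e_def field_simps)
    finally show ?thesis by simp
  qed
  obtain K where "2 * C * D / d < real K" using reals_Archimedean2 by blast
  then have "2 * C * D < real K * d" using d by (simp add: pos_divide_less_eq)
  with bound[of K] show False by simp
qed

lemma polar_hull_series_converges:
  assumes y: "y \<in> polar_hull"
  shows "\<exists>l\<in>carrier Y. (\<lambda>N. vnorm Y (partial_sum Y y N \<ominus>\<^bsub>Y\<^esub> l)) \<longlonglongrightarrow> 0"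
proof -
  let ?S = "partial_sum Y y"
  have Sc: "?S N \<in> carrier Y" for N by (rule partial_sum_closed[OF nY polar_hull_carrier[OF y]])
  have "\<exists>N. \<forall>m\<ge>N. \<forall>n\<ge>N. vnorm Y (?S m \<ominus>\<^bsub>Y\<^esub> ?S n) < e" if "0 < e" for e
  proof -
    obtain N where N: "\<And>m. m \<ge> N \<Longrightarrow> vnorm Y (?S m \<ominus>\<^bsub>Y\<^esub> ?S N) < e / 2"
      using polar_hull_partial_sums_cauchy[OF y, of "e / 2"] \<open>0 < e\<close> by auto
    have "vnorm Y (?S m \<ominus>\<^bsub>Y\<^esub> ?S n) < e" if "m \<ge> N" "n \<ge> N" for m n
      using ns_norm_minus_triangle[OF nY Sc[of m] Sc[of N] Sc[of n]]
          ns_norm_minus_commute[OF nY Sc[of N] Sc[of n]]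
        N[OF that(1)] N[OF that(2)] by simp
    then show ?thesis by blast
  qed
  then show ?thesis
    using Y[unfolded is_banach_space_def, THEN conjunct2, rule_format, of ?S] Sc by blast
qed

definition series_limit :: "(nat \<Rightarrow> 'b) \<Rightarrow> 'b" where
  "series_limit y =
     (SOME l. l \<in> carrier Y \<and> (\<lambda>N. vnorm Y (partial_sum Y y N \<ominus>\<^bsub>Y\<^esub> l)) \<longlonglongrightarrow> 0)"

lemma series_limit:
  assumes "y \<in> polar_hull"
  shows "series_limit y \<in> carrier Y"
    and "(\<lambda>N. vnorm Y (partial_sum Y y N \<ominus>\<^bsub>Y\<^esub> series_limit y)) \<longlonglongrightarrow> 0"
  using someI_ex[of "\<lambda>l. l \<in> carrier Y \<and> (\<lambda>N. vnorm Y (partial_sum Y y N \<ominus>\<^bsub>Y\<^esub> l)) \<longlonglongrightarrow> 0"]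
    polar_hull_series_converges[OF assms] unfolding series_limit_def by blast+

lemma series_limit_image:
  assumes x: "x \<in> unit_ball Lp"
  shows "series_limit (TE x) = T x"
proof -
  have xc: "x \<in> carrier Lp" using x by (simp add: unit_ball_def)
  have Tx: "T x \<in> carrier Y" using T xc by (auto simp: bounded_operator_def)
  show ?thesis
    using norm_limit_unique[OF nY partial_sum_closed[OF nY TE_carrier[OF xc]]
        series_limit[OF image_in_polar_hull[OF x]] Tx operator_series[OF ns p1 nY T xc]] .
qed

text \<open>
  The tail of \<open>g \<circ> T\<close> is uniformly small on the unit ball, and the hull inherits this bound on each
  finite block.
\<close>

lemma polar_hull_uniform_convergence:
  assumes g: "g \<in> dual Y" and e: "0 < e"
  shows "\<exists>N. \<forall>y\<in>polar_hull. norm (g (series_limit y) - (\<Sum>n<N. g (y n))) \<le> e"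
proof -
  obtain N where N: "\<And>M x. N \<le> M \<Longrightarrow> x \<in> unit_ball Lp \<Longrightarrow> norm (g (T (coord_restriction X {N..<M} x))) \<le> e"
    using functional_tails_vanish[OF ns p1 p dual_compose[OF T g lp_sum_normed[OF ns p1] nY] e] by blast
  have "norm (g (series_limit y) - (\<Sum>n<N. g (y n))) \<le> e" if y: "y \<in> polar_hull" for y
  proof -
    have yc: "\<And>n. y n \<in> carrier Y" by (rule polar_hull_carrier[OF y])
    have "norm ((\<Sum>n<M. g (y n)) - (\<Sum>n<N. g (y n))) \<le> e" if M: "N \<le> M" for M
    proof -
      \<comment> \<open>Padding with zero functionals turns the block from \<open>N\<close> to \<open>M\<close> into an initial segment.\<close>
      define f where "f n = (if n < N then (\<lambda>_. 0) else g)" for n :: nat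
      have f: "(\<Sum>n<M. f n (z n)) = (\<Sum>n\<in>{N..<M}. g (z n))" for z
        using sum_if_split_at[OF M, of "\<lambda>_. 0" "\<lambda>n. g (z n)"] by (simp add: f_def if_distribR)
      have fd: "f n \<in> dual Y" for n using g by (auto simp: f_def intro: dualI[of _ _ 0])
      have "norm (\<Sum>n<M. f n (y n)) \<le> e"
        using y fd
      proof (rule polar_hullD)
        fix x assume x: "x \<in> unit_ball Lp"
        then have xc: "x \<in> carrier Lp" by (simp add: unit_ball_def)
        show "norm (\<Sum>n<M. f n (TE x n)) \<le> e"
          unfolding f block_sum[OF g xc] using N[OF M x] .
      qed
      then show ?thesis by (simp add: f sum_split_at[OF M])
    qed
    then have "\<forall>\<^sub>F M in sequentially. norm ((\<Sum>n<M. g (y n)) - (\<Sum>n<N. g (y n))) \<le> e"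
      unfolding eventually_sequentially by blast
    moreover have "(\<lambda>M. \<Sum>n<M. g (y n)) \<longlonglongrightarrow> g (series_limit y)"
      using dual_tendsto[OF nY g partial_sum_closed[OF nY yc] series_limit[OF y]]
      by (simp add: dual_partial_sum[OF nY g yc])
    then have "(\<lambda>M. norm ((\<Sum>n<M. g (y n)) - (\<Sum>n<N. g (y n)))) \<longlonglongrightarrow>
        norm (g (series_limit y) - (\<Sum>n<N. g (y n)))"
      by (intro tendsto_norm tendsto_diff tendsto_const)
    ultimately show ?thesis by (intro tendsto_upperbound[where F = sequentially]) auto
  qed
  then show ?thesis by blast
qed

private abbreviation (input) "P \<equiv> product_topology (\<lambda>_::nat. weak_topology Y) UNIV"

private lemma topspace_P: "topspace P = {y. \<forall>n. y n \<in> carrier Y}"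
  by (auto simp: PiE_def Pi_def)

private lemma continuous_coordinate_functional:
  assumes g: "g \<in> dual Y"
  shows "continuous_map P euclidean (\<lambda>y. g (y n))"
proof -
  have "continuous_map (weak_topology Y) euclidean g"
    unfolding continuous_map_def using openin_weak_topology[OF g] by auto
  then show ?thesis
    using continuous_map_compose[OF continuous_map_product_projection[of n UNIV "\<lambda>_. weak_topology Y"]]
    by (auto simp: comp_def)
qed

text \<open>Each inequality in the definition involves finitely many coordinates through weakly
  continuous functionals.\<close>

lemma polar_hull_closed: "closedin P polar_hull"
proof -
  define F :: "nat \<times> (nat \<Rightarrow> 'b \<Rightarrow> 'k) \<times> real \<Rightarrow> (nat \<Rightarrow> 'b) set"
    where "F = (\<lambda>(N, g, c). {y \<in> topspace P. (\<Sum>n<N. g n (y n)) \<in> {z. norm z \<le> c}})"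
  define I :: "(nat \<times> (nat \<Rightarrow> 'b \<Rightarrow> 'k) \<times> real) set" where
    "I = {(N, g, c). (\<forall>n. g n \<in> dual Y) \<and> (\<forall>x\<in>unit_ball Lp. norm (\<Sum>n<N. g n (TE x n)) \<le> c)}"
  have "closedin P (F i)" if "i \<in> I" for i
  proof -
    obtain N g c where i: "i = (N, g, c)" by (cases i)
    have g: "g n \<in> dual Y" for n using that by (simp add: i I_def)
    have "continuous_map P euclidean (\<lambda>y. \<Sum>n<N. g n (y n))"
      by (intro continuous_map_sum continuous_coordinate_functional g) auto
    moreover have "closed {z :: 'k. norm z \<le> c}" by (intro closed_Collect_le continuous_intros)
    then have "closedin euclidean {z :: 'k. norm z \<le> c}" by simp
    ultimately show ?thesis
      unfolding i F_def prod.case by (rule closedin_continuous_map_preimage)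
  qed
  \<comment> \<open>A trivial member of \<open>I\<close>, so that the intersection over \<open>I\<close> lies in the carrier of the product space.\<close>
  moreover have "(0, \<lambda>_ _. 0, 0) \<in> I" by (auto simp: I_def intro: dualI[of _ _ 0])
  ultimately have "closedin P (\<Inter> (F ` I))" by (intro closedin_Inter) auto
  moreover have "\<Inter> (F ` I) = polar_hull"
  proof
    show "\<Inter> (F ` I) \<subseteq> polar_hull"
    proof
      fix y assume y: "y \<in> \<Inter> (F ` I)"
      then have "y \<in> F (0, \<lambda>_ _. 0, 0)" using \<open>(0, \<lambda>_ _. 0, 0) \<in> I\<close> by blast
      then have "\<forall>n. y n \<in> carrier Y" unfolding F_def topspace_P by simp
      moreover have "norm (\<Sum>n<N. g n (y n)) \<le> c" if "(N, g, c) \<in> I" for N g c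
        using y that unfolding F_def by blast
      ultimately show "y \<in> polar_hull" unfolding polar_hull_def I_def by blast
    qed
    show "polar_hull \<subseteq> \<Inter> (F ` I)"
      unfolding polar_hull_def F_def I_def topspace_P by auto
  qed
  ultimately show ?thesis by simp
qed

text \<open>Composed with a functional, summation is a uniform limit of the continuous partial sums.\<close>

lemma series_limit_continuous: "continuous_map (subtopology P polar_hull) (weak_topology Y) series_limit"
proof (rule continuous_map_weak_topologyI)
  let ?Q = "subtopology P polar_hull"
  have tQ: "topspace ?Q = polar_hull"
    using closedin_subset[OF polar_hull_closed] by auto
  show "series_limit y \<in> carrier Y" if "y \<in> topspace ?Q" for y
    using series_limit(1) that tQ by blast
  fix g assume g: "g \<in> dual Y"
  show "continuous_map ?Q euclidean (\<lambda>y. g (series_limit y))"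
    unfolding continuous_map_atin
  proof (intro ballI)
    fix z assume z: "z \<in> topspace ?Q"
    have zh: "z \<in> polar_hull" using z tQ by blast
    have "((\<lambda>y. g (series_limit y)) \<longlongrightarrow> g (series_limit z)) (atin ?Q z)"
    proof (rule tendstoI)
      fix e :: real assume e: "0 < e"
      obtain N where N: "\<And>y. y \<in> polar_hull \<Longrightarrow> norm (g (series_limit y) - (\<Sum>n<N. g (y n))) \<le> e / 3"
        using polar_hull_uniform_convergence[OF g, of "e / 3"] e by auto
      have "continuous_map ?Q euclidean (\<lambda>y. \<Sum>n<N. g (y n))"
        by (intro continuous_map_sum continuous_map_from_subtopology continuous_coordinate_functional g) auto
      then have "((\<lambda>y. \<Sum>n<N. g (y n)) \<longlongrightarrow> (\<Sum>n<N. g (z n))) (atin ?Q z)"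
        using z by (simp add: continuous_map_atin)
      then have "\<forall>\<^sub>F y in atin ?Q z. dist (\<Sum>n<N. g (y n)) (\<Sum>n<N. g (z n)) < e / 3"
        using e by (intro tendstoD) auto
      moreover have "\<forall>\<^sub>F y in atin ?Q z. y \<in> polar_hull"
        unfolding eventually_atin using z tQ openin_topspace[of ?Q] by (intro disjI2 exI[of _ polar_hull]) auto
      ultimately show "\<forall>\<^sub>F y in atin ?Q z. dist (g (series_limit y)) (g (series_limit z)) < e"
      proof eventually_elim
        case (elim y)
        show ?case
          using N[OF elim(2)] N[OF zh] elim(1)
            norm_triangle_ineq4[of "g (series_limit y) - (\<Sum>n<N. g (y n))" "g (series_limit z) - (\<Sum>n<N. g (z n))"]
            norm_triangle_ineq[of "(g (series_limit y) - (\<Sum>n<N. g (y n))) - (g (series_limit z) - (\<Sum>n<N. g (z n)))"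
              "(\<Sum>n<N. g (y n)) - (\<Sum>n<N. g (z n))"]
          by (simp add: dist_norm)
      qed
    qed
    then show "limitin euclidean (\<lambda>y. g (series_limit y)) (g (series_limit z)) (atin ?Q z)" by simp
  qed
qed

text \<open>
  The product of the weak closures \<open>K n\<close> of the images of the unit balls of the \<open>X n\<close> is compact, and
  so is its intersection with the hull. Summation carries this set onto a weakly compact set, which
  contains the image of the unit ball of the sum.
\<close>

theorem weakly_compact_on_lp_sum:
  assumes wc: "\<And>n. weakly_compact_operator (X n) Y (\<lambda>u. T (coord_embedding X n u))"
  shows "weakly_compact_operator Lp Y T"
proof -
  define K where "K n = weak_topology Y closure_of ((\<lambda>u. T (coord_embedding X n u)) ` unit_ball (X n))" for n
  have "compactin P (PiE UNIV K)"
    using wc by (simp add: compactin_PiE K_def weakly_compact_operator_def)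
  then have "compactin P (PiE UNIV K \<inter> polar_hull)"
    by (rule compact_Int_closedin[OF _ polar_hull_closed])
  then have "compactin (subtopology P polar_hull) (PiE UNIV K \<inter> polar_hull)"
    by (simp add: compactin_subtopology)
  then have "compactin (weak_topology Y) (series_limit ` (PiE UNIV K \<inter> polar_hull))"
    by (rule image_compactin[OF _ series_limit_continuous])
  then show ?thesis
  proof (rule weakly_compact_operatorI[OF nY T])
    show "(T ` unit_ball Lp) \<subseteq> series_limit ` (PiE UNIV K \<inter> polar_hull)"
    proof
      fix z assume "z \<in> T ` unit_ball Lp"
      then obtain x where x: "x \<in> unit_ball Lp" "z = T x" by blast
      then have xc: "x \<in> carrier Lp" "vnorm Lp x \<le> 1" by (auto simp: unit_ball_def)
      have "TE x n \<in> K n" for n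
      proof -
        have "x n \<in> unit_ball (X n)"
          using lp_coord_norm_le[OF ns p1 xc(1), of n] xc lp_sum_coord[of x p X n]
          by (simp add: unit_ball_def)
        moreover have "((\<lambda>u. T (coord_embedding X n u)) ` unit_ball (X n)) \<subseteq> K n"
          unfolding K_def
          using wc[of n] by (intro closure_of_subset) (auto simp: weakly_compact_operator_def bounded_operator_def unit_ball_def)
        ultimately show ?thesis by blast
      qed
      then have "TE x \<in> PiE UNIV K \<inter> polar_hull" using image_in_polar_hull[OF x(1)] by auto
      then show "z \<in> series_limit ` (PiE UNIV K \<inter> polar_hull)"
        unfolding x(2) series_limit_image[OF x(1), symmetric] by (rule imageI)
    qed
  qed
qed

end

section \<open>Property \<open>q\<close>-\<open>(V)\<close> of the sum\<close>

lemma property_V_coordinate: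
  fixes X :: "nat \<Rightarrow> ('k::real_or_complex, 'a) normed_space"
  assumes ns: "\<And>n. is_normed_space (X n)" and p: "1 \<le> p" and V: "property_V q (lp_sum p X)"
  shows "property_V q (X n)"
  unfolding property_V_def
proof (intro allI impI, elim conjE)
  fix Y :: "('k, nat \<Rightarrow> 'a) normed_space" and T
  assume Y: "is_banach_space Y" and T: "unconditionally_converging q (X n) Y T"
  note L = lp_sum_normed[where X = X, OF ns p]
  have nY: "is_normed_space Y" using Y by (simp add: is_banach_space_def)
  have T': "bounded_operator (X n) Y T" using T by (simp add: unconditionally_converging_def)
  have "weakly_compact_operator (lp_sum p X) Y (\<lambda>x. T (x n))"
    by (rule property_V_all_targets[OF V L Y
          unconditionally_converging_compose[OF projection_operator[where X = X and n = n, OF ns p] T L ns]])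
  then have K: "compactin (weak_topology Y) (weak_topology Y closure_of ((\<lambda>x. T (x n)) ` unit_ball (lp_sum p X)))"
    and S: "bounded_operator (lp_sum p X) Y (\<lambda>x. T (x n))"
    by (auto simp: weakly_compact_operator_def)
  show "weakly_compact_operator (X n) Y T"
  proof (rule weakly_compact_operatorI[OF nY T' K])
    have "T ` unit_ball (X n) \<subseteq> (\<lambda>x. T (x n)) ` unit_ball (lp_sum p X)"
    proof
      fix z assume "z \<in> T ` unit_ball (X n)"
      then obtain u where u: "u \<in> unit_ball (X n)" "z = T u" by blast
      have "coord_embedding X n u \<in> unit_ball (lp_sum p X)"
        using coord_embedding_norm[where X = X and n = n, OF ns p, of u] u(1)
        by (simp add: unit_ball_def)
      moreover have "z = T (coord_embedding X n u n)" using u(2) by (simp add: coord_embedding_def)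
      ultimately show "z \<in> (\<lambda>x. T (x n)) ` unit_ball (lp_sum p X)" by blast
    qed
    also have "\<dots> \<subseteq> weak_topology Y closure_of ((\<lambda>x. T (x n)) ` unit_ball (lp_sum p X))"
      using S by (intro closure_of_subset) (auto simp: bounded_operator_def unit_ball_def)
    finally show "(T ` unit_ball (X n)) \<subseteq> weak_topology Y closure_of ((\<lambda>x. T (x n)) ` unit_ball (lp_sum p X))" .
  qed
qed

lemma property_V_lp_sum:
  fixes X :: "nat \<Rightarrow> ('k::real_or_complex, 'a) normed_space"
  assumes ns: "\<And>n. is_normed_space (X n)" and p: "1 < p" and V: "\<And>n. property_V q (X n)"
  shows "property_V q (lp_sum p X)"
  unfolding property_V_def
proof (intro allI impI, elim conjE)
  fix Y :: "('k, nat \<Rightarrow> nat \<Rightarrow> 'a) normed_space" and T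
  assume Y: "is_banach_space Y" and T: "unconditionally_converging q (lp_sum p X) Y T"
  have p1: "1 \<le> p" using p by simp
  have T': "bounded_operator (lp_sum p X) Y T" using T by (simp add: unconditionally_converging_def)
  have "weakly_compact_operator (X n) Y (\<lambda>u. T (coord_embedding X n u))" for n
    by (rule property_V_all_targets[OF V ns Y
          unconditionally_converging_compose[OF coord_embedding_operator[where X = X and n = n, OF ns p1] T ns
            lp_sum_normed[where X = X, OF ns p1]]])
  then show "weakly_compact_operator (lp_sum p X) Y T"
    by (rule weakly_compact_on_lp_sum[OF ns p Y T'])
qed

theorem theorem3p5:
  fixes X :: "nat \<Rightarrow> ('k::real_or_complex, 'a) normed_space"
    and p q :: real
  assumes "\<And>n. is_banach_space (X n)"
    and "1 \<le> q" and "1 < p"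
  shows "property_V q (lp_sum p X) \<longleftrightarrow> (\<forall>n. property_V q (X n))"
proof -
  have ns: "is_normed_space (X n)" for n using assms(1)[of n] by (simp add: is_banach_space_def)
  show ?thesis
    using property_V_coordinate[OF ns, of p q] property_V_lp_sum[OF ns \<open>1 < p\<close>, of q] \<open>1 < p\<close> by auto
qed

end
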